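(* Let $\mathcal{W}(4)$ be a non-singular $4$-web of $(\mathbb{C}^2,0)$ presented by $F(x,y,p)=a_0p^4+a_1p^3+a_2p^2+a_3p+a_4\in\mathcal{O}[p]$, and let $(E,\nabla)$ be the connection associated with $F$. Then there exists an adapted basis of $(E,\nabla)$ in which the curvature matrix is $$\begin{pmatrix} 3\kappa & 3\,\partial_x(\kappa)+L_1 & 3\,\partial_y(\kappa)+L_2\\ 0&0&0\\ 0&0&0\end{pmatrix}dx\wedge dy,$$ where $\kappa,L_1,L_2\in\mathcal{O}$ are the functions attached to the web that are defined in the context.
   Context: Notation. $\mathcal{O}=\mathbb{C}\{x,y\}$ is the ring of convergent power series, i.e. germs of holomorphic functions at $0\in\mathbb{C}^2$; $\Omega^1=\mathcal{O}dx\oplus\mathcal{O}dy$; everything is local at $0$. Webs. A non-singular $4$-web $\mathcal{W}(4)$ of $(\mathbb{C}^2,0)$ is given by the level curves $\{F_i=\mathrm{const}\}$ (leaves) of $4$ germs $F_i\in\mathcal{O}$ with $F_i(0)=0$ and $dF_i(0)\wedge dF_j(0)\ne0$ for $i<j$. It is presented by $F$, where $a_0(0)\neq0$ and the $p$-discriminant of $F$ is non-zero at $0$, if the leaves are the integral curves of $F(x,y,y')=0$. Equivalently, the four roots $p_1,\dots,p_4\in\mathcal{O}$ of $F(x,y,\cdot)$, which are distinct at $0$, are the slopes of the leaves. The polynomial $P_{\mathcal{W}(4)}$ and $L_1,L_2$. Let $P_{\mathcal{W}(4)}=-v_1p^3-v_2p^2-v_3p-v_4$, $v_i\in\mathcal{O}$,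 be the unique polynomial of degree $\le3$ with $P_{\mathcal{W}(4)}(x,y,p_i)=\partial_x(p_i)+p_i\partial_y(p_i)$ for $1\le i\le4$. The leaves satisfy $y''=P_{\mathcal{W}(4)}(x,y,y')$. Put $$L_1=2\partial_x\partial_yv_3-\partial_x^2v_2-3\partial_y^2v_4-3\partial_y(v_2v_4)+2v_3\partial_yv_3-v_3\partial_xv_2+3\partial_x(v_1v_4)+3v_4\partial_xv_1,$$ $$L_2=2\partial_x\partial_yv_2-\partial_y^2v_3-3\partial_x^2v_1+3\partial_x(v_1v_3)-2v_2\partial_xv_2+v_2\partial_yv_3-3\partial_y(v_1v_4)-3v_1\partial_yv_4.$$ The system $L_1=L_2=0$ is the classical (Liouville) condition for $\mathcal{W}(4)$ to be linearizable. The system $\mathcal{M}(4)$. For $b=(b_3,b_4)\in\mathcal{O}^2$ put $r(p)=b_3p+b_4$ and $F'_i=\partial_pF(x,y,p_i)$. There is a unique polynomial $Q_b\in\mathcal{O}[p]$ of degree $\le2$ with $Q_b(p_i)=F'_i\big[\partial_x(r(p_i)/F'_i)+\partial_y(p_ir(p_i)/F'_i)\big]$ for $i=1,\dots,4$. Its coefficients have the form $$\begin{aligned}p^0:&\ \partial_x(b_4)+A_{1,1}b_3+A_{1,2}b_4,\\ p^1:&\ \partial_x(b_3)+\partial_y(b_4)+A_{2,1}b_3+A_{2,2}b_4,\\ p^2:&\ \partial_y(b_3)+A_{3,1}b_3+A_{3,2}b_4,\end{aligned}$$ with $A_{j,l}\in\mathcal{O}$, and $\mathcal{M}(4)$ is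 the system stating that these three expressions vanish. One has $A_{1,1}=-v_4$, $A_{3,2}=v_1$, $A_{2,1}=A_{1,2}-v_3$, $A_{3,1}=A_{2,2}-v_2$. The function $\kappa$. It is defined by $\kappa\,dx\wedge dy=d\big((A_{1,2}-\tfrac13v_3)dx+(A_{2,2}-\tfrac23v_2)dy\big)$; it depends only on $\mathcal{W}(4)$ and not on the presentation $F$. The connection $(E,\nabla)$ and adapted bases. Let $J_m$ be the free $\mathcal{O}$-module of sections of the bundle of $m$-jets of $\mathcal{O}^2$, with elements $(f_{a,b})_{a+b\le m}$, $f_{a,b}\in\mathcal{O}^2$, where $f_{a,b}$ is a formal substitute for $\partial_x^a\partial_y^bf$. Let $R_0\subset J_1$ be the jets satisfying formally $\mathcal{M}(4)$, and $R_1\subset J_2$ the jets satisfying formally $\mathcal{M}(4)$ and its first partial derivatives. The projection $R_1\to R_0$ is an isomorphism of free modules of rank $3$, and $R_0\to J_0=\mathcal{O}^2$ is surjective with kernel of rank $1$. Let $E=R_1$. The Spencer operator $D:J_2\to\Omega^1\otimes J_1$, $D(f)_{a,b}=(\partial_xf_{a,b}-f_{a+1,b})dx+(\partial_yf_{a,b}-f_{a,b+1})dy$ for $a+b\le1$, maps $R_1$ into $\Omega^1\otimes R_0$; composing with the inverse of $R_1\cong R_0$ gives $\nabla:E\to\Omega^1\otimes E$. A basis of $E$ is adapted if its first vector spans the kernel of $E\cong R_0\to\mathcal{O}^2$. If $\gamma$ is the connection matrix in the basis ($\nabla f=df+\gamma f$ on coordinate columns), the curvature matrix is $d\gamma+\gamma\wedge\gamma$;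 in an adapted basis only its first row can be non-zero. *)

theory Defs
  imports
    "HOL-Analysis.Analysis"
    "HOL-Computational_Algebra.Formal_Power_Series"
    "HOL-Computational_Algebra.Polynomial"
    "Subresultants.Resultant_Prelim"
begin

(* Throughout, $ and vec refer to the finite Cartesian products of HOL-Analysis. *)
no_notation Matrix.vec_index (infixl "$" 100)
no_notation Infinite_Set_Sum.abs_summable_on (infix "abs'_summable'_on" 50)
hide_const (open) Matrix.mat Matrix.vec Matrix.vec_index Module.smult
hide_type (open) Matrix.vec Matrix.mat

section \<open>Germs of holomorphic functions in two variables\<close>

text \<open>A power series in $x, y$ is an element of \<^typ>\<open>complex fps fps\<close>, the coefficient of
  $x^m y^n$ being \<open>fps_nth (fps_nth f m) n\<close>.\<close>

definition converges :: "complex fps fps \<Rightarrow> bool" where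
  "converges f \<longleftrightarrow> (\<exists>r>0. \<forall>x y. norm x < r \<longrightarrow> norm y < r \<longrightarrow>
     (\<lambda>(m, n). fps_nth (fps_nth f m) n * x ^ m * y ^ n) summable_on UNIV)"

lemma converges_iff_bound:
  "converges f \<longleftrightarrow> (\<exists>C R. C \<ge> 0 \<and> R > 0 \<and> (\<forall>m n. norm (fps_nth (fps_nth f m) n) \<le> C * R ^ (m + n)))"
proof
  assume "converges f"
  then obtain r where r: "r > 0" "\<And>x y. norm x < r \<Longrightarrow> norm y < r \<Longrightarrow>
     (\<lambda>(m, n). fps_nth (fps_nth f m) n * x ^ m * y ^ n) summable_on UNIV"
    unfolding converges_def by blast
  define s where "s = r / 2"
  have s: "s > 0" "s < r" using r(1) by (auto simp: s_def)
  let ?g = "\<lambda>(m, n). fps_nth (fps_nth f m) n * complex_of_real s ^ m * complex_of_real s ^ n"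
  have "?g summable_on UNIV" using r(2)[of "complex_of_real s" "complex_of_real s"] s by auto
  then have ab: "?g abs_summable_on UNIV"
    by (simp add: summable_on_iff_abs_summable_on_complex)
  define C where "C = infsum (\<lambda>z. norm (?g z)) UNIV"
  have le: "norm (?g z) \<le> C" for z
    using finite_sum_le_infsum[OF ab, of "{z}"] by (simp add: C_def)
  have "C \<ge> 0" using le[of "(0,0)"] norm_ge_zero order_trans by blast
  moreover have "norm (fps_nth (fps_nth f m) n) \<le> C * (1 / s) ^ (m + n)" for m n
    using le[of "(m, n)"] s
    by (simp add: norm_mult norm_power power_add power_one_over field_simps)
  ultimately show "\<exists>C R. C \<ge> 0 \<and> R > 0 \<and> (\<forall>m n. norm (fps_nth (fps_nth f m) n) \<le> C * R ^ (m + n))"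
    using s by (intro exI[of _ C] exI[of _ "1 / s"]) auto
next
  assume "\<exists>C R. C \<ge> 0 \<and> R > 0 \<and> (\<forall>m n. norm (fps_nth (fps_nth f m) n) \<le> C * R ^ (m + n))"
  then obtain C R where CR: "C \<ge> 0" "R > 0"
    "\<And>m n. norm (fps_nth (fps_nth f m) n) \<le> C * R ^ (m + n)" by blast
  show "converges f" unfolding converges_def
  proof (intro exI[of _ "1 / R"] conjI allI impI)
    show "0 < 1 / R" using CR by simp
    fix x y :: complex assume xy: "norm x < 1 / R" "norm y < 1 / R"
    define a b where "a = R * norm x" and "b = R * norm y"
    have ab: "0 \<le> a" "a < 1" "0 \<le> b" "b < 1"
      using xy CR by (auto simp: a_def b_def field_simps)
    have geo: "((\<lambda>n. t ^ n) has_sum (1 / (1 - t))) UNIV" if "0 \<le> t" "t < 1" for t :: real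
      using that by (intro norm_summable_imp_has_sum) (auto intro: geometric_sums summable_geometric)
    have "(\<lambda>z. C * (a ^ fst z * b ^ snd z)) summable_on (UNIV \<times> UNIV)"
    proof (rule summable_on_cmult_right, rule has_sum_imp_summable)
      show "((\<lambda>z. a ^ fst z * b ^ snd z) has_sum (1 / (1 - a) * (1 / (1 - b)))) (UNIV \<times> UNIV)"
      proof (rule has_sum_SigmaI)
        show "((\<lambda>n. a ^ fst (m, n) * b ^ snd (m, n)) has_sum (a ^ m * (1 / (1 - b)))) UNIV" for m
          using has_sum_cmult_right[OF geo[OF ab(3,4)], of "a ^ m"] by simp
        show "((\<lambda>m. a ^ m * (1 / (1 - b))) has_sum (1 / (1 - a) * (1 / (1 - b)))) UNIV"
          using has_sum_cmult_left[OF geo[OF ab(1,2)]] .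
        show "(\<lambda>z. a ^ fst z * b ^ snd z) summable_on (UNIV \<times> UNIV)"
        proof (rule summable_on_SigmaI)
          show "((\<lambda>n. a ^ fst (m, n) * b ^ snd (m, n)) has_sum (a ^ m * (1 / (1 - b)))) UNIV" for m
            using has_sum_cmult_right[OF geo[OF ab(3,4)], of "a ^ m"] by simp
          show "(\<lambda>m. a ^ m * (1 / (1 - b))) summable_on UNIV"
            using has_sum_imp_summable[OF has_sum_cmult_left[OF geo[OF ab(1,2)]]] .
        qed (use ab in auto)
      qed
    qed
    then have "(\<lambda>z. C * (a ^ fst z * b ^ snd z)) abs_summable_on UNIV"
      using ab CR by simp
    then have "(\<lambda>(m, n). fps_nth (fps_nth f m) n * x ^ m * y ^ n) abs_summable_on UNIV"
    proof (rule Infinite_Sum.abs_summable_on_comparison_test)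
      fix z :: "nat \<times> nat"
      obtain m n where z: "z = (m, n)" by (cases z)
      have "norm (fps_nth (fps_nth f m) n) * (norm x ^ m * norm y ^ n)
          \<le> C * R ^ (m + n) * (norm x ^ m * norm y ^ n)"
        by (intro mult_right_mono CR) auto
      also have "\<dots> = C * (a ^ m * b ^ n)"
        by (simp add: a_def b_def power_add power_mult_distrib)
      finally show "norm (case z of (m, n) \<Rightarrow> fps_nth (fps_nth f m) n * x ^ m * y ^ n)
          \<le> norm (C * (a ^ fst z * b ^ snd z))"
        using ab CR by (simp add: z norm_mult norm_power mult.assoc)
    qed
    then show "(\<lambda>(m, n). fps_nth (fps_nth f m) n * x ^ m * y ^ n) summable_on UNIV"
      by (simp add: summable_on_iff_abs_summable_on_complex)
  qed
qed

lemma converges_iff_bound_ge: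
  "converges f \<longleftrightarrow> (\<exists>C\<ge>0. \<exists>S>0. \<forall>R\<ge>S. \<forall>m n. norm (fps_nth (fps_nth f m) n) \<le> C * R ^ (m + n))"
proof
  assume "converges f"
  then obtain C S where *: "C \<ge> 0" "S > 0" "\<And>m n. norm (fps_nth (fps_nth f m) n) \<le> C * S ^ (m + n)"
    unfolding converges_iff_bound by blast
  have "norm (fps_nth (fps_nth f m) n) \<le> C * R ^ (m + n)" if "R \<ge> S" for R m n
    using *(1,2) by (intro order_trans[OF *(3)] mult_left_mono power_mono that) auto
  with * show "\<exists>C\<ge>0. \<exists>S>0. \<forall>R\<ge>S. \<forall>m n. norm (fps_nth (fps_nth f m) n) \<le> C * R ^ (m + n)"
    by blast
qed (unfold converges_iff_bound, blast)

lemma converges_const: "converges (fps_const (fps_const c))"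
  unfolding converges_iff_bound
  by (intro exI[of _ "norm c"] exI[of _ 1]) auto

lemma converges_0: "converges 0"
  using converges_const[of 0] by simp

lemma converges_1: "converges 1"
  using converges_const[of 1] by simp

lemma converges_uminus: "converges f \<Longrightarrow> converges (- f)"
  unfolding converges_iff_bound by simp

lemma converges_add:
  assumes "converges f" "converges g"
  shows "converges (f + g)"
proof -
  obtain C S where f: "C \<ge> 0" "S > 0"
    "\<And>R m n. R \<ge> S \<Longrightarrow> norm (fps_nth (fps_nth f m) n) \<le> C * R ^ (m + n)"
    using assms(1) unfolding converges_iff_bound_ge by blast
  obtain D T where g: "D \<ge> 0" "T > 0"
    "\<And>R m n. R \<ge> T \<Longrightarrow> norm (fps_nth (fps_nth g m) n) \<le> D * R ^ (m + n)"
    using assms(2) unfolding converges_iff_bound_ge by blast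
  have "norm (fps_nth (fps_nth (f + g) m) n) \<le> (C + D) * (max S T) ^ (m + n)" for m n
    using norm_triangle_ineq[of "fps_nth (fps_nth f m) n" "fps_nth (fps_nth g m) n"]
      f(3)[of "max S T" m n] g(3)[of "max S T" m n] by (simp add: distrib_right)
  then show ?thesis unfolding converges_iff_bound using f g
    by (intro exI[of _ "C + D"] exI[of _ "max S T"]) auto
qed

lemma converges_mult:
  assumes "converges f" "converges g"
  shows "converges (f * g)"
proof -
  obtain C S where f: "C \<ge> 0" "S > 0"
    "\<And>R m n. R \<ge> S \<Longrightarrow> norm (fps_nth (fps_nth f m) n) \<le> C * R ^ (m + n)"
    using assms(1) unfolding converges_iff_bound_ge by blast
  obtain D T where g: "D \<ge> 0" "T > 0"
    "\<And>R m n. R \<ge> T \<Longrightarrow> norm (fps_nth (fps_nth g m) n) \<le> D * R ^ (m + n)"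
    using assms(2) unfolding converges_iff_bound_ge by blast
  define R where "R = max S T"
  have R: "R \<ge> S" "R \<ge> T" "R > 0" using f g by (auto simp: R_def)
  have "norm (fps_nth (fps_nth (f * g) m) n) \<le> C * D * (2 * R) ^ (m + n)" for m n
  proof -
    have "norm (fps_nth (fps_nth (f * g) m) n)
        = norm (\<Sum>i=0..m. \<Sum>j=0..n. fps_nth (fps_nth f i) j * fps_nth (fps_nth g (m - i)) (n - j))"
      by (simp add: fps_mult_nth fps_sum_nth)
    also have "\<dots> \<le> (\<Sum>i=0..m. \<Sum>j=0..n. C * D * R ^ (m + n))"
    proof (intro sum_norm_le)
      fix i j assume i: "i \<in> {0..m}" and j: "j \<in> {0..n}"
      have "norm (fps_nth (fps_nth f i) j * fps_nth (fps_nth g (m - i)) (n - j))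
          \<le> (C * R ^ (i + j)) * (D * R ^ ((m - i) + (n - j)))"
        unfolding norm_mult using f g R by (intro mult_mono) auto
      also have "\<dots> = C * D * R ^ ((i + j) + ((m - i) + (n - j)))"
        by (simp only: power_add) (simp add: mult_ac)
      also have "(i + j) + ((m - i) + (n - j)) = m + n" using i j by auto
      finally show "norm (fps_nth (fps_nth f i) j * fps_nth (fps_nth g (m - i)) (n - j))
          \<le> C * D * R ^ (m + n)" .
    qed
    also have "\<dots> = (real (Suc m) * real (Suc n)) * (C * D * R ^ (m + n))"
      by simp
    also have "\<dots> \<le> (2 ^ m * 2 ^ n) * (C * D * R ^ (m + n))"
    proof (intro mult_right_mono mult_mono)
      have "real (Suc k) \<le> 2 ^ k" for k
        by (metis Suc_leI less_exp of_nat_le_iff of_nat_numeral of_nat_power)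
      then show "real (Suc m) \<le> 2 ^ m" "real (Suc n) \<le> 2 ^ n" by blast+
    qed (use f g R in auto)
    also have "\<dots> = C * D * (2 * R) ^ (m + n)"
      by (simp add: power_add power_mult_distrib)
    finally show ?thesis .
  qed
  then show ?thesis unfolding converges_iff_bound using f g R
    by (intro exI[of _ "C * D"] exI[of _ "2 * R"]) auto
qed

lemma converges_deriv_aux:
  assumes "converges f" "\<And>m n. norm (fps_nth (fps_nth g m) n)
     \<le> 2 ^ (m + n) * norm (fps_nth (fps_nth f (m + i)) (n + j))"
  shows "converges g"
proof -
  obtain C R where f: "C \<ge> 0" "R > 0" "\<And>m n. norm (fps_nth (fps_nth f m) n) \<le> C * R ^ (m + n)"
    using assms(1) unfolding converges_iff_bound by blast
  have "norm (fps_nth (fps_nth g m) n) \<le> (C * R ^ (i + j)) * (2 * R) ^ (m + n)" for m n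
  proof -
    have "norm (fps_nth (fps_nth g m) n) \<le> 2 ^ (m + n) * (C * R ^ ((m + i) + (n + j)))"
      by (rule order_trans[OF assms(2)]) (intro mult_left_mono f, simp)
    also have "\<dots> = (C * R ^ (i + j)) * (2 * R) ^ (m + n)"
      by (simp add: power_add power_mult_distrib)
    finally show ?thesis .
  qed
  then show ?thesis unfolding converges_iff_bound using f
    by (intro exI[of _ "C * R ^ (i + j)"] exI[of _ "2 * R"]) auto
qed

lemma Suc_le_two_power: "real (Suc m) \<le> 2 ^ (m + n)"
proof -
  have "Suc m \<le> 2 ^ m" by (simp add: Suc_leI)
  also have "\<dots> \<le> 2 ^ (m + n)" by (intro power_increasing) auto
  finally show ?thesis by (metis of_nat_le_iff of_nat_numeral of_nat_power)
qed

lemma converges_deriv_x: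
  assumes "converges f"
  shows "converges (fps_deriv f)"
proof (rule converges_deriv_aux[OF assms, of _ 1 0])
  fix m n
  have "fps_nth (fps_nth (fps_deriv f) m) n = of_nat (Suc m) * fps_nth (fps_nth f (m + 1)) n"
    by (simp add: fps_of_nat[symmetric] del: of_nat_Suc)
  then show "norm (fps_nth (fps_nth (fps_deriv f) m) n)
      \<le> 2 ^ (m + n) * norm (fps_nth (fps_nth f (m + 1)) (n + 0))"
    using Suc_le_two_power[of m n] by (simp add: norm_mult mult_right_mono del: of_nat_Suc)
qed

lemma converges_deriv_y:
  assumes "converges f"
  shows "converges (Abs_fps (\<lambda>m. fps_deriv (fps_nth f m)))"
proof (rule converges_deriv_aux[OF assms, of _ 0 1])
  fix m n
  show "norm (fps_nth (fps_nth (Abs_fps (\<lambda>m. fps_deriv (fps_nth f m))) m) n)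
      \<le> 2 ^ (m + n) * norm (fps_nth (fps_nth f (m + 0)) (n + 1))"
    using Suc_le_two_power[of n m]
    by (simp add: norm_mult mult_right_mono add.commute del: of_nat_Suc)
qed

typedef germ = "{f :: complex fps fps. converges f}"
  using converges_0 by blast

setup_lifting type_definition_germ

instantiation germ :: idom
begin

lift_definition zero_germ :: germ is 0 by (rule converges_0)
lift_definition one_germ :: germ is 1 by (rule converges_1)
lift_definition uminus_germ :: "germ \<Rightarrow> germ" is uminus by (rule converges_uminus)
lift_definition plus_germ :: "germ \<Rightarrow> germ \<Rightarrow> germ" is plus by (rule converges_add)
lift_definition minus_germ :: "germ \<Rightarrow> germ \<Rightarrow> germ" is minus
  by (metis converges_add converges_uminus diff_conv_add_uminus)
lift_definition times_germ :: "germ \<Rightarrow> germ \<Rightarrow> germ" is times by (rule converges_mult)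

instance
  by standard (transfer; simp add: algebra_simps)+

end

instantiation germ :: inverse
begin

(* meaningful for units only, i.e. for germs not vanishing at the origin *)
definition inverse_germ :: "germ \<Rightarrow> germ" where
  "inverse_germ f = (if f dvd 1 then THE g. f * g = 1 else 0)"

definition divide_germ :: "germ \<Rightarrow> germ \<Rightarrow> germ" where
  "divide_germ f g = f * inverse g"

instance ..

end

lift_definition at0 :: "germ \<Rightarrow> complex" is "\<lambda>f. fps_nth (fps_nth f 0) 0" .

lift_definition pdx :: "germ \<Rightarrow> germ" ("\<partial>\<^sub>x") is fps_deriv
  by (rule converges_deriv_x)

lift_definition pdy :: "germ \<Rightarrow> germ" ("\<partial>\<^sub>y") is "\<lambda>f. Abs_fps (\<lambda>m. fps_deriv (fps_nth f m))"
  by (rule converges_deriv_y)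


section \<open>Webs and their presentations\<close>

definition nonsingular_4web :: "(4 \<Rightarrow> germ) \<Rightarrow> bool" where
  "nonsingular_4web W \<longleftrightarrow> (\<forall>i. at0 (W i) = 0) \<and>
     (\<forall>i j. i \<noteq> j \<longrightarrow> at0 (\<partial>\<^sub>x (W i) * \<partial>\<^sub>y (W j) - \<partial>\<^sub>y (W i) * \<partial>\<^sub>x (W j)) \<noteq> 0)"

text \<open>\<open>leaf_slope p f\<close>: the level curves of $f$ are the integral curves of $y' = p(x,y)$.\<close>

definition leaf_slope :: "germ \<Rightarrow> germ \<Rightarrow> bool" where
  "leaf_slope p f \<longleftrightarrow> \<partial>\<^sub>x f + p * \<partial>\<^sub>y f = 0"

text \<open>With this normalization the $p$-discriminant of $F = a_0 p^4 + \dots$ differs from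
  $a_0^6 \prod_{i<j} (p_i - p_j)^2$ by the factor $\pm a_0$, a unit in the situation at hand.\<close>

definition p_discriminant :: "germ poly \<Rightarrow> germ" where
  "p_discriminant F = resultant F (pderiv F)"

text \<open>In a non-singular web the slopes of the leaves are pairwise distinct at the origin, so that
  the last condition says that they are the four roots of $F$.\<close>

definition presents :: "germ poly \<Rightarrow> (4 \<Rightarrow> germ) \<Rightarrow> bool" where
  "presents F W \<longleftrightarrow> degree F \<le> 4 \<and> at0 (coeff F 4) \<noteq> 0 \<and> at0 (p_discriminant F) \<noteq> 0 \<and>
     (\<forall>i. \<exists>p. leaf_slope p (W i) \<and> poly F p = 0)"

definition web_poly :: "(4 \<Rightarrow> germ) \<Rightarrow> germ poly" where
  "web_poly W = (THE P. degree P \<le> 3 \<and>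
     (\<forall>i p. leaf_slope p (W i) \<longrightarrow> poly P p = \<partial>\<^sub>x p + p * \<partial>\<^sub>y p))"

text \<open>\<open>web_poly W\<close> is $-v_1 p^3 - v_2 p^2 - v_3 p - v_4$.\<close>

definition v_coeff :: "(4 \<Rightarrow> germ) \<Rightarrow> nat \<Rightarrow> germ" where
  "v_coeff W k = - coeff (web_poly W) (4 - k)"

definition L1 :: "(4 \<Rightarrow> germ) \<Rightarrow> germ" where
  "L1 W = (let v1 = v_coeff W 1; v2 = v_coeff W 2; v3 = v_coeff W 3; v4 = v_coeff W 4 in
     2 * \<partial>\<^sub>x (\<partial>\<^sub>y v3) - \<partial>\<^sub>x (\<partial>\<^sub>x v2) - 3 * \<partial>\<^sub>y (\<partial>\<^sub>y v4) - 3 * \<partial>\<^sub>y (v2 * v4)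
     + 2 * v3 * \<partial>\<^sub>y v3 - v3 * \<partial>\<^sub>x v2 + 3 * \<partial>\<^sub>x (v1 * v4) + 3 * v4 * \<partial>\<^sub>x v1)"

definition L2 :: "(4 \<Rightarrow> germ) \<Rightarrow> germ" where
  "L2 W = (let v1 = v_coeff W 1; v2 = v_coeff W 2; v3 = v_coeff W 3; v4 = v_coeff W 4 in
     2 * \<partial>\<^sub>x (\<partial>\<^sub>y v2) - \<partial>\<^sub>y (\<partial>\<^sub>y v3) - 3 * \<partial>\<^sub>x (\<partial>\<^sub>x v1) + 3 * \<partial>\<^sub>x (v1 * v3)
     - 2 * v2 * \<partial>\<^sub>x v2 + v2 * \<partial>\<^sub>y v3 - 3 * \<partial>\<^sub>y (v1 * v4) - 3 * v1 * \<partial>\<^sub>y v4)"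


section \<open>The linear differential system of a presentation\<close>

text \<open>A vector $b = (b_3, b_4)$ is indexed by the type \<^typ>\<open>2\<close>: $b_3$ is \<open>b $ 1\<close> and $b_4$ is
  \<open>b $ 2\<close>.\<close>

definition Q_poly :: "germ poly \<Rightarrow> germ ^ 2 \<Rightarrow> germ poly" where
  "Q_poly F b = (THE Q. degree Q \<le> 2 \<and>
     (\<forall>p. poly F p = 0 \<longrightarrow>
        (let r = b $ 1 * p + b $ 2; F' = poly (pderiv F) p
         in poly Q p = F' * (\<partial>\<^sub>x (r / F') + \<partial>\<^sub>y (p * r / F')))))"

definition A_mat :: "germ poly \<Rightarrow> germ ^ 2 ^ 3" where
  "A_mat F = (THE A. \<forall>b.
     coeff (Q_poly F b) 0 = \<partial>\<^sub>x (b $ 2) + A $ 1 $ 1 * b $ 1 + A $ 1 $ 2 * b $ 2 \<and>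
     coeff (Q_poly F b) 1 = \<partial>\<^sub>x (b $ 1) + \<partial>\<^sub>y (b $ 2) + A $ 2 $ 1 * b $ 1 + A $ 2 $ 2 * b $ 2 \<and>
     coeff (Q_poly F b) 2 = \<partial>\<^sub>y (b $ 1) + A $ 3 $ 1 * b $ 1 + A $ 3 $ 2 * b $ 2)"

definition kappa :: "germ poly \<Rightarrow> (4 \<Rightarrow> germ) \<Rightarrow> germ" where
  "kappa F W = \<partial>\<^sub>x (A_mat F $ 2 $ 2 - 2 / 3 * v_coeff W 2) - \<partial>\<^sub>y (A_mat F $ 1 $ 2 - 1 / 3 * v_coeff W 3)"


section \<open>Jets and the connection\<close>

text \<open>\<open>f a b\<close> is the formal substitute $f_{a,b}$ for $\partial_x^a \partial_y^b f$.\<close>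

type_synonym jet = "nat \<Rightarrow> nat \<Rightarrow> germ ^ 2"

definition vec_map :: "('a \<Rightarrow> 'b) \<Rightarrow> 'a ^ 'n \<Rightarrow> 'b ^ 'n" where
  "vec_map d c = (\<chi> i. d (c $ i))"

definition matrix_map :: "('a \<Rightarrow> 'b) \<Rightarrow> 'a ^ 'n ^ 'm \<Rightarrow> 'b ^ 'n ^ 'm" where
  "matrix_map d A = (\<chi> i j. d (A $ i $ j))"

definition jets :: "nat \<Rightarrow> jet set" where
  "jets m = {f. \<forall>a b. a + b > m \<longrightarrow> f a b = 0}"

definition M4 :: "germ poly \<Rightarrow> jet \<Rightarrow> germ ^ 3" where
  "M4 F f = vector [f 1 0 $ 2, f 1 0 $ 1 + f 0 1 $ 2, f 0 1 $ 1] + A_mat F *v f 0 0"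

text \<open>The principal part of \<open>M4\<close> has constant coefficients; hence its formal partial
  derivatives shift the jet, and the only coefficients to be differentiated are those of
  \<open>A_mat\<close>.\<close>

definition M4_x :: "germ poly \<Rightarrow> jet \<Rightarrow> germ ^ 3" where
  "M4_x F f = M4 F (\<lambda>a b. f (a + 1) b) + matrix_map \<partial>\<^sub>x (A_mat F) *v f 0 0"

definition M4_y :: "germ poly \<Rightarrow> jet \<Rightarrow> germ ^ 3" where
  "M4_y F f = M4 F (\<lambda>a b. f a (b + 1)) + matrix_map \<partial>\<^sub>y (A_mat F) *v f 0 0"

definition R0 :: "germ poly \<Rightarrow> jet set" where
  "R0 F = {f \<in> jets 1. M4 F f = 0}"

definition R1 :: "germ poly \<Rightarrow> jet set" where
  "R1 F = {f \<in> jets 2. M4 F f = 0 \<and> M4_x F f = 0 \<and> M4_y F f = 0}"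

definition truncate1 :: "jet \<Rightarrow> jet" where
  "truncate1 f = (\<lambda>a b. if a + b \<le> 1 then f a b else 0)"

text \<open>In what follows, a pair $(g, h)$ stands for $dx \otimes g + dy \otimes h$.\<close>

definition spencer :: "jet \<Rightarrow> jet \<times> jet" where
  "spencer f = (truncate1 (\<lambda>a b. vec_map \<partial>\<^sub>x (f a b) - f (a + 1) b),
                truncate1 (\<lambda>a b. vec_map \<partial>\<^sub>y (f a b) - f a (b + 1)))"

text \<open>The module $E$ is \<open>R1 F\<close>; its projection to \<open>R0 F\<close> is \<open>truncate1\<close>, which is inverted by
  \<open>the_inv_into (R1 F) truncate1\<close>.\<close>

definition nabla :: "germ poly \<Rightarrow> jet \<Rightarrow> jet \<times> jet" where
  "nabla F f = map_prod (the_inv_into (R1 F) truncate1) (the_inv_into (R1 F) truncate1) (spencer f)"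

definition lincomb :: "(3 \<Rightarrow> jet) \<Rightarrow> germ ^ 3 \<Rightarrow> jet" where
  "lincomb e c = (\<lambda>a b. \<Sum>i\<in>UNIV. c $ i *s e i a b)"

definition adapted_basis :: "germ poly \<Rightarrow> (3 \<Rightarrow> jet) \<Rightarrow> bool" where
  "adapted_basis F e \<longleftrightarrow> (\<forall>i. e i \<in> R1 F) \<and> (\<forall>f\<in>R1 F. \<exists>!c. f = lincomb e c) \<and>
     {f \<in> R1 F. f 0 0 = 0} = {\<lambda>a b. c *s e 1 a b | c. True}"

definition connection_matrix ::
    "germ poly \<Rightarrow> (3 \<Rightarrow> jet) \<Rightarrow> (germ ^ 3 ^ 3) \<times> (germ ^ 3 ^ 3) \<Rightarrow> bool" where
  "connection_matrix F e \<gamma> \<longleftrightarrow> (\<forall>c. nabla F (lincomb e c) =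
     (lincomb e (vec_map \<partial>\<^sub>x c + fst \<gamma> *v c), lincomb e (vec_map \<partial>\<^sub>y c + snd \<gamma> *v c)))"

text \<open>This is the coefficient of $dx \wedge dy$ in $d\gamma + \gamma \wedge \gamma$.\<close>

definition curvature_matrix :: "(germ ^ 3 ^ 3) \<times> (germ ^ 3 ^ 3) \<Rightarrow> germ ^ 3 ^ 3" where
  "curvature_matrix \<gamma> = matrix_map \<partial>\<^sub>x (snd \<gamma>) - matrix_map \<partial>\<^sub>y (fst \<gamma>)
     + (fst \<gamma> ** snd \<gamma> - snd \<gamma> ** fst \<gamma>)"

end

(*
The slopes p_i of the leaves are the roots of F, and Euler's formulas sum p_i^k / F'(p_i) = 0 for
k <= 2 show that the cubic interpolating the divergences F'(p_i) [d_x (1/F'(p_i)) + d_y (p_i/F'(p_i))]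
has degree at most 2, with leading coefficient v_1. Hence the coefficients of M(4) are those of the
web polynomial together with two further functions, and with v_1 = a, v_2 = 3b, v_3 = 3c, v_4 = d,
p = A_{1,2} - c, q = A_{2,2} - 2b one gets kappa dx /\ dy = d(p dx + q dy).

A jet in E is determined by (u, w, z) = (b_3, b_4, d_x b_3). In the basis with coordinates k, where
u = k_2, w = -k_3, z = k_1/3 + (c - p) k_2 + b k_3, the connection matrix is explicit
and the curvature is a direct computation; the factor 1/3 in z is the normalization that makes the
first row come out as 3 kappa, 3 d_x kappa + L_1, 3 d_y kappa + L_2.
*)
theory Submission
  imports Defs
begin

section \<open>Units among the convergent power series\<close>

text \<open>The equation \<open>f * h = 1\<close> expresses c times a coefficient of h through
  coefficients of h of lower total degree. Induction on that degree gives geometric growth with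
  ratio \<open>S = R / k\<close>: since R = k S, each factor \<open>R ^ (i + j)\<close> becomes
  \<open>S ^ (i + j)\<close> times the small number \<open>k ^ (i + j)\<close>.\<close>

lemma converges_reciprocal:
  assumes "converges f" and "f * h = 1"
  shows "converges h"
proof -
  define c where "c = fps_nth (fps_nth f 0) 0"
  let ?f = "\<lambda>i j. fps_nth (fps_nth f i) j" and ?h = "\<lambda>i j. fps_nth (fps_nth h i) j"
  obtain C R where CR: "C \<ge> 0" "R > 0" "\<And>m n. norm (?f m n) \<le> C * R ^ (m + n)"
    using assms(1) unfolding converges_iff_bound by blast
  have conv: "(\<Sum>(i,j)\<in>{0..m} \<times> {0..n}. ?f i j * ?h (m - i) (n - j)) = fps_nth (fps_nth 1 m) n" for m n
    by (simp add: assms(2)[symmetric] fps_mult_nth fps_sum_nth sum.cartesian_product)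
  have c1: "c * ?h 0 0 = 1"
    using conv[of 0 0] by (simp add: c_def)
  then have c0: "norm c > 0" by auto
  \<comment> \<open>The bound 1/2 gives 1/(1 - k)^2 \<le> 1 + 8k; the other bound makes 8kC at most
    \<open>norm c\<close>, which closes the induction. Taking C + 1 keeps the denominator positive
    when C = 0.\<close>
  define k where "k = min (1/2) (norm c / (8 * (C + 1)))"
  have k: "0 < k" "k \<le> 1/2" "8 * k * (C + 1) \<le> norm c"
  proof -
    show "0 < k" using c0 CR by (auto simp: k_def)
    show "k \<le> 1/2" unfolding k_def by (rule min.cobounded1)
    have "k \<le> norm c / (8 * (C + 1))" by (simp add: k_def)
    then show "8 * k * (C + 1) \<le> norm c" using CR by (simp add: field_simps)
  qed
  define S where "S = R / k"
  have S: "S > 0" "R = k * S" using k CR by (auto simp: S_def)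
  have geo: "(\<Sum>i\<in>{0..n}. k ^ i) \<le> 1 / (1 - k)" for n
    using sum_le_suminf[of "\<lambda>i. k ^ i" "{0..n}"] k by (simp add: suminf_geometric)
  have geo2: "(\<Sum>(i,j)\<in>{0..m} \<times> {0..n} - {(0,0)}. k ^ (i + j)) \<le> 8 * k" for m n
  proof -
    have "(\<Sum>(i,j)\<in>{0..m} \<times> {0..n}. k ^ (i + j)) = (\<Sum>i\<in>{0..m}. k ^ i) * (\<Sum>j\<in>{0..n}. k ^ j)"
      by (simp add: sum_product sum.cartesian_product power_add)
    also have "\<dots> \<le> 1 / (1 - k) * (1 / (1 - k))"
      using k by (intro mult_mono geo sum_nonneg) auto
    also have "\<dots> \<le> 1 + 8 * k"
    proof -
      have "(1 + 8 * k) * ((1 - k) * (1 - k)) - 1 = k * (6 - 15 * k + 8 * k * k)"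
        by (simp add: algebra_simps)
      \<comment> \<open>In this form every factor is visibly nonnegative for 0 < k \<le>
        1/2.\<close>
      also have "\<dots> = k * ((1 - 2 * k) * (11/2 - 4 * k) + 1/2)" by (simp add: field_simps)
      also have "\<dots> \<ge> 0" using k by (intro mult_nonneg_nonneg add_nonneg_nonneg) auto
      finally show ?thesis using k by (simp add: divide_le_eq)
    qed
    finally show ?thesis
      using sum.remove[of "{0..m} \<times> {0..n}" "(0,0)" "\<lambda>(i,j). k ^ (i + j)"] by simp
  qed
  have bound: "norm (?h m n) \<le> S ^ (m + n) / norm c" for m n
  proof (induction "m + n" arbitrary: m n rule: less_induct)
    case less
    show ?case
    proof (cases "m = 0 \<and> n = 0")
      case True
      have "norm c * norm (?h 0 0) = 1" by (metis c1 norm_mult norm_one)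
      then show ?thesis using True c0 by (simp add: field_simps)
    next
      case False
      let ?A = "{0..m} \<times> {0..n} - {(0,0)}"
      have one: "fps_nth (fps_nth 1 m) n = (0::complex)"
        using False by (cases "m = 0") auto
      have "c * ?h m n = - (\<Sum>(i,j)\<in>?A. ?f i j * ?h (m - i) (n - j))"
        using conv[of m n] sum.remove[of "{0..m} \<times> {0..n}" "(0,0)" "\<lambda>(i,j). ?f i j * ?h (m - i) (n - j)"]
        unfolding one by (simp add: c_def add_eq_0_iff)
      then have "norm c * norm (?h m n) = norm (\<Sum>(i,j)\<in>?A. ?f i j * ?h (m - i) (n - j))"
        by (simp only: norm_mult[symmetric] norm_minus_cancel)
      also have "\<dots> \<le> (\<Sum>(i,j)\<in>?A. C * S ^ (m + n) / norm c * k ^ (i + j))"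
      proof (rule sum_norm_le)
        fix z assume "z \<in> ?A"
        then obtain i j where z: "z = (i, j)"
          and ij: "i \<in> {0..m}" "j \<in> {0..n}" "(i, j) \<noteq> (0, 0)"
          by (cases z) blast
        have le: "norm (?h (m - i) (n - j)) \<le> S ^ ((m - i) + (n - j)) / norm c"
          by (rule less) (use ij in auto)
        have "norm (?f i j * ?h (m - i) (n - j))
            \<le> (C * R ^ (i + j)) * (S ^ ((m - i) + (n - j)) / norm c)"
          unfolding norm_mult using CR S c0 by (intro mult_mono le CR) auto
        also have "\<dots> = C * (S ^ (i + j) * S ^ ((m - i) + (n - j))) / norm c * k ^ (i + j)"
          by (simp add: S(2) power_mult_distrib)
        also have "S ^ (i + j) * S ^ ((m - i) + (n - j)) = S ^ (m + n)"
          unfolding power_add[symmetric] using ij by (intro arg_cong[where f = "\<lambda>n. S ^ n"]) auto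
        finally show "norm (case z of (i, j) \<Rightarrow> ?f i j * ?h (m - i) (n - j))
            \<le> (case z of (i, j) \<Rightarrow> C * S ^ (m + n) / norm c * k ^ (i + j))"
          by (simp only: z prod.case)
      qed
      also have "\<dots> = C * S ^ (m + n) / norm c * (\<Sum>(i,j)\<in>?A. k ^ (i + j))"
        by (simp add: sum_distrib_left case_prod_unfold)
      also have "\<dots> \<le> C * S ^ (m + n) / norm c * (8 * k)"
        using CR S by (intro mult_left_mono geo2) auto
      also have "\<dots> = (8 * k * C) * (S ^ (m + n) / norm c)" by simp
      also have "\<dots> \<le> norm c * (S ^ (m + n) / norm c)"
        using k S by (intro mult_right_mono) (auto simp: algebra_simps)
      finally show ?thesis using c0 by (simp add: field_simps)
    qed
  qed
  show ?thesis unfolding converges_iff_bound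
    using S c0 bound by (intro exI[of _ "1 / norm c"] exI[of _ S]) auto
qed

text \<open>A formal reciprocal exists because the constant term is nonzero, and it converges by
  \<open>converges_reciprocal\<close>. Reciprocals in a commutative ring are unique, so the
  description defining \<open>inverse\<close> selects it.\<close>

lemma germ_unit:
  assumes "at0 f \<noteq> 0"
  shows "f * inverse f = 1"
proof -
  have "\<exists>g. f * g = 1" using assms
  proof transfer
    fix f :: "complex fps fps"
    assume f: "converges f" and "fps_nth (fps_nth f 0) 0 \<noteq> 0"
    \<comment> \<open>Inversion proceeds in two stages: the part free of x is a series in y over the
      field of complex numbers, and its reciprocal starts the recursion in x.\<close>
    then have "fps_nth f 0 * inverse (fps_nth f 0) = 1" by (intro inverse_mult_eq_1')
    then have "f * fps_right_inverse f (inverse (fps_nth f 0)) = 1" by (rule fps_right_inverse)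
    with converges_reciprocal[OF f this] show "\<exists>g\<in>Collect converges. f * g = 1" by blast
  qed
  then obtain g where g: "f * g = 1" by blast
  moreover from g have "f dvd 1" by (metis dvdI)
  moreover have "(THE g. f * g = 1) = g"
    by (rule the_equality, rule g) (metis g mult.assoc mult.commute mult.right_neutral)
  ultimately show ?thesis by (simp add: inverse_germ_def)
qed

section \<open>Evaluation at the origin and the two commuting derivations\<close>

lemma at0_0 [simp]: "at0 0 = 0" by transfer simp
lemma at0_1 [simp]: "at0 1 = 1" by transfer simp
lemma at0_add [simp]: "at0 (f + g) = at0 f + at0 g" by transfer simp
lemma at0_uminus [simp]: "at0 (- f) = - at0 f" by transfer simp
lemma at0_diff [simp]: "at0 (f - g) = at0 f - at0 g" by transfer simp
lemma at0_mult [simp]: "at0 (f * g) = at0 f * at0 g" by transfer simp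
lemma at0_numeral [simp]: "at0 (numeral n) = numeral n"
  by (induction n) (simp_all only: numeral.simps at0_add at0_1)
lemma at0_prod: "at0 (\<Prod>i\<in>I. f i) = (\<Prod>i\<in>I. at0 (f i))"
  by (induction I rule: infinite_finite_induct) simp_all

lemma pdx_0 [simp]: "\<partial>\<^sub>x 0 = 0" by transfer simp
lemma pdx_1 [simp]: "\<partial>\<^sub>x 1 = 0" by transfer simp
lemma pdx_add [simp]: "\<partial>\<^sub>x (f + g) = \<partial>\<^sub>x f + \<partial>\<^sub>x g" by transfer simp
lemma pdx_uminus [simp]: "\<partial>\<^sub>x (- f) = - \<partial>\<^sub>x f" by transfer simp
lemma pdx_diff [simp]: "\<partial>\<^sub>x (f - g) = \<partial>\<^sub>x f - \<partial>\<^sub>x g" by transfer simp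
lemma pdx_mult: "\<partial>\<^sub>x (f * g) = \<partial>\<^sub>x f * g + f * \<partial>\<^sub>x g" by transfer (simp add: algebra_simps)
lemma pdx_numeral [simp]: "\<partial>\<^sub>x (numeral n) = 0"
  by (induction n) (simp_all only: numeral.simps pdx_add pdx_1 add_0)
lemma pdx_sum: "\<partial>\<^sub>x (\<Sum>i\<in>I. f i) = (\<Sum>i\<in>I. \<partial>\<^sub>x (f i))"
  by (induction I rule: infinite_finite_induct) simp_all

lemma pdy_0 [simp]: "\<partial>\<^sub>y 0 = 0" by transfer (simp add: fps_eq_iff)
lemma pdy_1 [simp]: "\<partial>\<^sub>y 1 = 0" by transfer (simp add: fps_eq_iff)
lemma pdy_add [simp]: "\<partial>\<^sub>y (f + g) = \<partial>\<^sub>y f + \<partial>\<^sub>y g" by transfer (simp add: fps_eq_iff algebra_simps)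
lemma pdy_uminus [simp]: "\<partial>\<^sub>y (- f) = - \<partial>\<^sub>y f" by transfer (simp add: fps_eq_iff)
lemma pdy_diff [simp]: "\<partial>\<^sub>y (f - g) = \<partial>\<^sub>y f - \<partial>\<^sub>y g" by transfer (simp add: fps_eq_iff algebra_simps)
text \<open>The derivation in y acts on each coefficient in x separately, so the Leibniz rule
  applies inside the Cauchy product.\<close>

lemma pdy_mult: "\<partial>\<^sub>y (f * g) = \<partial>\<^sub>y f * g + f * \<partial>\<^sub>y g"
proof transfer
  have *: "fps_deriv (\<Sum>i\<in>I. a i :: complex fps) = (\<Sum>i\<in>I. fps_deriv (a i))" for I :: "nat set" and a
    by (induction I rule: infinite_finite_induct) simp_all
  show "Abs_fps (\<lambda>m. fps_deriv (fps_nth (f * g) m)) =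
      Abs_fps (\<lambda>m. fps_deriv (fps_nth f m)) * g + f * Abs_fps (\<lambda>m. fps_deriv (fps_nth g m))"
    for f g :: "complex fps fps"
  proof (rule fps_ext)
    fix m
    have "fps_deriv (fps_nth (f * g) m) =
        (\<Sum>i=0..m. fps_nth f i * fps_deriv (fps_nth g (m - i)) + fps_deriv (fps_nth f i) * fps_nth g (m - i))"
      unfolding fps_mult_nth * by (simp only: fps_deriv_mult)
    then show "fps_nth (Abs_fps (\<lambda>m. fps_deriv (fps_nth (f * g) m))) m = fps_nth
      (Abs_fps (\<lambda>m. fps_deriv (fps_nth f m)) * g + f * Abs_fps (\<lambda>m. fps_deriv (fps_nth g m))) m"
      by (simp only: fps_nth_Abs_fps fps_add_nth fps_mult_nth[of _ _ m] sum.distrib add.commute)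
  qed
qed
lemma pdy_numeral [simp]: "\<partial>\<^sub>y (numeral n) = 0"
  by (induction n) (simp_all only: numeral.simps pdy_add pdy_1 add_0)
lemma pdy_sum: "\<partial>\<^sub>y (\<Sum>i\<in>I. f i) = (\<Sum>i\<in>I. \<partial>\<^sub>y (f i))"
  by (induction I rule: infinite_finite_induct) simp_all

lemma pdx_pdy_commute: "\<partial>\<^sub>x (\<partial>\<^sub>y f) = \<partial>\<^sub>y (\<partial>\<^sub>x f)"
  by transfer (simp add: fps_eq_iff fps_of_nat[symmetric] algebra_simps)

lemma pdx_inverse:
  assumes "f * g = 1"
  shows "\<partial>\<^sub>x g = - (\<partial>\<^sub>x f * g * g)"
proof -
  have "\<partial>\<^sub>x f * g + f * \<partial>\<^sub>x g = 0"
    using arg_cong[OF assms, of "\<partial>\<^sub>x"] by (simp add: pdx_mult)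
  then have "g * (\<partial>\<^sub>x f * g) + (f * g) * \<partial>\<^sub>x g = 0"
    by (metis distrib_left mult.commute mult.left_commute mult_zero_right)
  then show ?thesis
    by (simp add: assms add_eq_0_iff mult_ac)
qed

lemma pdy_inverse:
  assumes "f * g = 1"
  shows "\<partial>\<^sub>y g = - (\<partial>\<^sub>y f * g * g)"
proof -
  have "\<partial>\<^sub>y f * g + f * \<partial>\<^sub>y g = 0"
    using arg_cong[OF assms, of "\<partial>\<^sub>y"] by (simp add: pdy_mult)
  then have "g * (\<partial>\<^sub>y f * g) + (f * g) * \<partial>\<^sub>y g = 0"
    by (metis distrib_left mult.commute mult.left_commute mult_zero_right)
  then show ?thesis
    by (simp add: assms add_eq_0_iff mult_ac)
qed

section \<open>Lagrange interpolation at simple roots\<close>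

text \<open>Both sides agree at \<open>card S\<close> points and in the coefficient of degree
  \<open>card S\<close>, so their difference has more zeros than its degree permits.\<close>

lemma poly_eq_smult_prod_roots:
  fixes F :: "'a::idom poly"
  assumes "finite S" "degree F \<le> card S" "\<And>x. x \<in> S \<Longrightarrow> poly F x = 0"
  shows "F = smult (coeff F (card S)) (\<Prod>x\<in>S. [:-x, 1:])"
proof (rule poly_eqI_degree_lead_coeff[where n = "card S" and A = S])
  have deg: "degree (\<Prod>x\<in>S. [:-x, 1:]) = card S"
    by (subst degree_prod_sum_eq) auto
  moreover have "lead_coeff (\<Prod>x\<in>S. [:-x, 1:]) = 1"
    by (simp add: lead_coeff_prod)
  ultimately show "coeff F (card S) = coeff (smult (coeff F (card S)) (\<Prod>x\<in>S. [:-x, 1:])) (card S)"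
    by simp
  show "degree (smult (coeff F (card S)) (\<Prod>x\<in>S. [:-x, 1:])) \<le> card S"
    using degree_smult_le[of _ "\<Prod>x\<in>S. [:-x, 1:]"] deg by metis
  show "poly F z = poly (smult (coeff F (card S)) (\<Prod>x\<in>S. [:-x, 1:])) z" if "z \<in> S" for z
    using that assms by (force simp: poly_prod)
qed (use assms in auto)

text \<open>After the Leibniz rule for the product of linear factors, only the summand omitting the
  factor of x survives at x.\<close>

lemma poly_pderiv_at_root:
  fixes F :: "'a::idom poly"
  assumes "finite S" "degree F \<le> card S" "\<And>x. x \<in> S \<Longrightarrow> poly F x = 0" "x \<in> S"
  shows "poly (pderiv F) x = coeff F (card S) * (\<Prod>y\<in>S - {x}. x - y)"
proof -
  have "poly (pderiv F) x = coeff F (card S) * (\<Sum>z\<in>S. \<Prod>y\<in>S - {z}. x - y)"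
    by (subst arg_cong[OF poly_eq_smult_prod_roots[OF assms(1-3)], of pderiv])
      (simp_all add: pderiv_smult pderiv_prod pderiv_pCons poly_sum poly_prod)
  also have "(\<Sum>z\<in>S. \<Prod>y\<in>S - {z}. x - y) = (\<Sum>z\<in>{x}. \<Prod>y\<in>S - {z}. x - y)"
    using assms by (intro sum.mono_neutral_right) auto
  finally show ?thesis by simp
qed

text \<open>The function \<omega> supplies the reciprocals 1/F'(x), which lets interpolation take
  place in a domain without division.\<close>

locale simple_roots =
  fixes S :: "'a::idom set" and F :: "'a poly" and \<omega> :: "'a \<Rightarrow> 'a"
  assumes finite_roots: "finite S" and roots_nonempty: "S \<noteq> {}"
    and degree_F: "degree F \<le> card S"
    and root: "\<And>x. x \<in> S \<Longrightarrow> poly F x = 0"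
    and omega: "\<And>x. x \<in> S \<Longrightarrow> poly (pderiv F) x * \<omega> x = 1"
begin

text \<open>By \<open>poly_pderiv_at_root\<close> the usual denominator, the product of the
  differences x - y, has the inverse a_0 \<omega>(x), where a_0 is
  \<open>coeff F (card S)\<close>.\<close>

definition lagrange :: "('a \<Rightarrow> 'a) \<Rightarrow> 'a poly" where
  "lagrange g = (\<Sum>x\<in>S. smult (coeff F (card S) * g x * \<omega> x) (\<Prod>y\<in>S - {x}. [:-y, 1:]))"

lemma
  assumes "x \<in> S"
  shows degree_lagrange_factor: "degree (\<Prod>y\<in>S - {x}. [:-y, 1:]) = card S - 1"
    and coeff_lagrange_factor: "coeff (\<Prod>y\<in>S - {x}. [:-y, 1:]) (card S - 1) = 1"
proof -
  show deg: "degree (\<Prod>y\<in>S - {x}. [:-y, 1:]) = card S - 1"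
    using assms finite_roots by (subst degree_prod_sum_eq) auto
  have "lead_coeff (\<Prod>y\<in>S - {x}. [:-y, 1:]) = 1" by (simp add: lead_coeff_prod)
  then show "coeff (\<Prod>y\<in>S - {x}. [:-y, 1:]) (card S - 1) = 1" using deg by simp
qed

lemma degree_lagrange: "degree (lagrange g) < card S"
proof -
  have "degree (lagrange g) \<le> card S - 1"
    unfolding lagrange_def using degree_lagrange_factor finite_roots
    by (intro degree_sum_le order_trans[OF degree_smult_le]) auto
  also have "\<dots> < card S" using finite_roots roots_nonempty by (simp add: card_gt_0_iff)
  finally show ?thesis .
qed

lemma poly_lagrange:
  assumes "x \<in> S"
  shows "poly (lagrange g) x = g x"
proof -
  have "poly (lagrange g) x
      = (\<Sum>z\<in>S. coeff F (card S) * g z * \<omega> z * (\<Prod>y\<in>S - {z}. x - y))"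
    by (simp add: lagrange_def poly_sum poly_prod)
  also have "\<dots> = (\<Sum>z\<in>{x}. coeff F (card S) * g z * \<omega> z * (\<Prod>y\<in>S - {z}. x - y))"
    using assms finite_roots by (intro sum.mono_neutral_right) auto
  also have "\<dots> = g x * (poly (pderiv F) x * \<omega> x)"
    using poly_pderiv_at_root[OF finite_roots degree_F root assms] by (simp add: mult_ac)
  finally show ?thesis using omega[OF assms] by simp
qed

lemma poly_eq_lagrange:
  assumes "degree P < card S"
  shows "P = lagrange (poly P)"
  by (rule poly_eqI_degree[of S]) (use assms degree_lagrange in \<open>auto simp: poly_lagrange\<close>)

text \<open>Euler's formulas $\sum_x x^k/F'(x) = 0$ for $k < n - 1$ and $= 1/a_0$ for $k = n - 1$,
  where $n$ is the number of roots.\<close>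

lemma euler_formula:
  assumes "degree P < card S"
  shows "coeff P (card S - 1) = coeff F (card S) * (\<Sum>x\<in>S. poly P x * \<omega> x)"
  by (subst poly_eq_lagrange[OF assms])
    (simp add: lagrange_def coeff_sum coeff_lagrange_factor[simplified] sum_distrib_left mult.assoc)

end

section \<open>The slope and divergence polynomials of four roots\<close>

lemma poly_degree_le:
  fixes P :: "'a::comm_semiring_1 poly"
  assumes "degree P \<le> n"
  shows "poly P x = (\<Sum>i\<le>n. coeff P i * x ^ i)"
  unfolding poly_altdef using assms
  by (intro sum.mono_neutral_left) (auto simp: coeff_eq_0)

locale germ_roots = simple_roots S F \<omega> for S :: "germ set" and F \<omega> +
  assumes card_roots: "card S = 4"
begin

abbreviation slope_poly :: "germ poly" where
  "slope_poly \<equiv> lagrange (\<lambda>p. \<partial>\<^sub>x p + p * \<partial>\<^sub>y p)"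

text \<open>The interpolated value is F'(p) times \<open>\<partial>\<^sub>x (\<omega> p) +
  \<partial>\<^sub>y (p * \<omega> p)\<close>, rewritten with the rule for differentiating a
  reciprocal; see \<open>divergence_omega\<close>.\<close>

definition divergence_poly :: "germ poly" where
  "divergence_poly = lagrange (\<lambda>p. \<partial>\<^sub>y p -
     (\<partial>\<^sub>x (poly (pderiv F) p) + p * \<partial>\<^sub>y (poly (pderiv F) p)) * \<omega> p)"

lemma degree_lagrange_le: "degree (lagrange g) \<le> 3"
  using degree_lagrange[of g] by (simp add: card_roots)

lemma lead_F: "coeff F 4 \<noteq> 0"
proof
  assume "coeff F 4 = 0"
  obtain x where x: "x \<in> S" using roots_nonempty by blast
  have "poly (pderiv F) x = 0"
    using poly_pderiv_at_root[OF finite_roots degree_F root x] \<open>coeff F 4 = 0\<close>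
    by (simp add: card_roots)
  then show False using omega[OF x] by simp
qed

lemma sum_power_omega: "k < 3 \<Longrightarrow> (\<Sum>x\<in>S. x ^ k * \<omega> x) = 0"
  using euler_formula[of "monom 1 k"] lead_F
  by (simp add: card_roots degree_monom_eq poly_monom)

lemma divergence_omega:
  assumes "x \<in> S"
  shows "poly divergence_poly x * \<omega> x = \<partial>\<^sub>x (\<omega> x) + \<partial>\<^sub>y (x * \<omega> x)"
  using assms pdx_inverse[OF omega[OF assms]] pdy_inverse[OF omega[OF assms]]
  by (simp add: divergence_poly_def poly_lagrange pdy_mult algebra_simps)

text \<open>Euler's formula turns the coefficient into a sum over the roots, and that sum is built
  from derivatives of the sums of \<omega>(x) and x \<omega>(x), both of which vanish.\<close>

lemma coeff_divergence_3: "coeff divergence_poly 3 = 0"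
proof -
  have "coeff divergence_poly 3 = coeff F 4 * (\<Sum>x\<in>S. poly divergence_poly x * \<omega> x)"
    using euler_formula[of divergence_poly] degree_lagrange
    by (simp add: card_roots divergence_poly_def)
  also have "(\<Sum>x\<in>S. poly divergence_poly x * \<omega> x) = (\<Sum>x\<in>S. \<partial>\<^sub>x (\<omega> x) + \<partial>\<^sub>y (x * \<omega> x))"
    by (intro sum.cong refl divergence_omega)
  also have "\<dots> = \<partial>\<^sub>x (\<Sum>x\<in>S. \<omega> x) + \<partial>\<^sub>y (\<Sum>x\<in>S. x * \<omega> x)"
    by (simp add: sum.distrib pdx_sum pdy_sum)
  also have "\<dots> = 0" using sum_power_omega[of 0] sum_power_omega[of 1] by simp
  finally show ?thesis by simp
qed

lemma degree_divergence: "degree divergence_poly \<le> 2"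
proof (rule degree_le, intro allI impI)
  fix i :: nat assume "2 < i"
  then consider "i = 3" | "i > 3" by linarith
  then show "coeff divergence_poly i = 0"
  proof cases
    case 2
    then show ?thesis unfolding divergence_poly_def
      by (intro coeff_eq_0 le_less_trans[OF degree_lagrange_le])
  qed (simp add: coeff_divergence_3)
qed

text \<open>Multiplying the divergence by x leaves derivatives of the sums of x \<omega>(x) and x^2
  \<omega>(x), which vanish, minus the correction from differentiating x itself. This correction is
  the value of \<open>slope_poly\<close>; for a web the result is A_{3,2} = v_1.\<close>

lemma coeff_divergence_2: "coeff divergence_poly 2 = - coeff slope_poly 3"
proof -
  \<comment> \<open>Multiplication by the variable moves the coefficient to degree 3, where Euler's
    formula reads it; \<open>degree_divergence\<close> keeps the product within degree 3.\<close>
  have "coeff divergence_poly 2 = coeff (pCons 0 divergence_poly) (card S - 1)"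
    by (simp add: card_roots numeral_3_eq_3 numeral_2_eq_2)
  also have "\<dots> = coeff F 4 * (\<Sum>x\<in>S. x * poly divergence_poly x * \<omega> x)"
    by (subst euler_formula)
      (use degree_divergence in \<open>simp_all add: card_roots degree_pCons_eq_if\<close>)
  also have "(\<Sum>x\<in>S. x * poly divergence_poly x * \<omega> x)
      = (\<Sum>x\<in>S. \<partial>\<^sub>x (x * \<omega> x) + \<partial>\<^sub>y (x ^ 2 * \<omega> x) - poly slope_poly x * \<omega> x)"
  proof (intro sum.cong refl)
    fix x assume x: "x \<in> S"
    have "x * (poly divergence_poly x * \<omega> x)
        = \<partial>\<^sub>x (x * \<omega> x) + \<partial>\<^sub>y (x ^ 2 * \<omega> x) - poly slope_poly x * \<omega> x"
      unfolding divergence_omega[OF x] poly_lagrange[OF x]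
      by (simp add: pdx_mult pdy_mult power2_eq_square algebra_simps)
    then show "x * poly divergence_poly x * \<omega> x
        = \<partial>\<^sub>x (x * \<omega> x) + \<partial>\<^sub>y (x ^ 2 * \<omega> x) - poly slope_poly x * \<omega> x"
      by (simp add: mult.assoc)
  qed
  also have "\<dots> = - (\<Sum>x\<in>S. poly slope_poly x * \<omega> x)"
    using sum_power_omega[of 1] sum_power_omega[of 2]
    by (simp add: sum.distrib sum_subtractf pdx_sum[symmetric] pdy_sum[symmetric])
  finally show ?thesis
    using euler_formula[of slope_poly] degree_lagrange by (simp add: card_roots)
qed

end

section \<open>The coefficients of the linear differential system\<close>

context germ_roots
begin

text \<open>This is the explicit form of Q_b. The term \<open>- coeff P 3 * w\<close> is the
  quadratic coefficient of D, replaced by means of \<open>coeff_divergence_2\<close>.\<close>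

definition system_poly :: "germ ^ 2 \<Rightarrow> germ poly" where
  "system_poly b = (let u = b $ 1; w = b $ 2; P = slope_poly; D = divergence_poly in
     [: \<partial>\<^sub>x w + coeff P 0 * u + coeff D 0 * w,
        \<partial>\<^sub>x u + \<partial>\<^sub>y w + (coeff D 0 + coeff P 1) * u + coeff D 1 * w,
        \<partial>\<^sub>y u + (coeff D 1 + coeff P 2) * u - coeff P 3 * w :])"

lemma degree_system_poly: "degree (system_poly b) \<le> 2"
  by (simp add: system_poly_def Let_def)

text \<open>The Leibniz rule separates the derivative of r along the leaf, where
  \<open>slope_poly\<close> enters through the derivative of x, from r times the divergence.\<close>

lemma poly_system_poly:
  assumes x: "x \<in> S"
  shows "poly (system_poly b) x = poly (pderiv F) x *
    (\<partial>\<^sub>x ((b $ 1 * x + b $ 2) * \<omega> x) + \<partial>\<^sub>y (x * (b $ 1 * x + b $ 2) * \<omega> x))"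
proof -
  define u w r F' where "u = b $ 1" and "w = b $ 2" and "r = u * x + w" and "F' = poly (pderiv F) x"
  have F': "F' * \<omega> x = 1" using omega[OF x] by (simp add: F'_def)
  have P: "\<partial>\<^sub>x x + x * \<partial>\<^sub>y x =
      coeff slope_poly 0 + coeff slope_poly 1 * x + coeff slope_poly 2 * x ^ 2 + coeff slope_poly 3 * x ^ 3"
    using poly_degree_le[OF degree_lagrange_le] poly_lagrange[OF x]
    by (simp add: numeral_3_eq_3 numeral_2_eq_2 algebra_simps)
  have "poly divergence_poly x = coeff divergence_poly 0 + coeff divergence_poly 1 * x - coeff slope_poly 3 * x ^ 2"
    using poly_degree_le[OF degree_divergence] coeff_divergence_2
    by (simp add: numeral_2_eq_2 algebra_simps)
  then have D: "(\<partial>\<^sub>x (\<omega> x) + \<partial>\<^sub>y (x * \<omega> x)) * F'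
      = coeff divergence_poly 0 + coeff divergence_poly 1 * x - coeff slope_poly 3 * x ^ 2"
    using divergence_omega[OF x] F' by (metis mult.assoc mult.commute mult.right_neutral)
  have "F' * (\<partial>\<^sub>x (r * \<omega> x) + \<partial>\<^sub>y (x * r * \<omega> x))
      = (F' * \<omega> x) * (\<partial>\<^sub>x r + x * \<partial>\<^sub>y r) + r * ((\<partial>\<^sub>x (\<omega> x) + \<partial>\<^sub>y (x * \<omega> x)) * F')"
    by (simp add: pdx_mult pdy_mult algebra_simps)
  also have "\<dots> = \<partial>\<^sub>x u * x + \<partial>\<^sub>x w + x * (\<partial>\<^sub>y u * x + \<partial>\<^sub>y w) + u * (\<partial>\<^sub>x x + x * \<partial>\<^sub>y x)
      + r * ((\<partial>\<^sub>x (\<omega> x) + \<partial>\<^sub>y (x * \<omega> x)) * F')"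
    unfolding F' by (simp add: r_def pdx_mult pdy_mult algebra_simps)
  also have "\<dots> = poly (system_poly b) x"
    \<comment> \<open>The cubic term of u times the slope polynomial cancels against u x times the
      quadratic term of the divergence polynomial.\<close>
    unfolding P D by (simp add: system_poly_def Let_def u_def w_def r_def power2_eq_square power3_eq_cube algebra_simps)
  finally show ?thesis by (simp add: u_def w_def r_def F'_def)
qed

end

section \<open>The slopes of a presented web as the roots of F\<close>

locale presented_web =
  fixes W :: "4 \<Rightarrow> germ" and F :: "germ poly"
  assumes nonsingular: "nonsingular_4web W" and presented: "presents F W"
begin

definition slope :: "4 \<Rightarrow> germ" where
  "slope i = (SOME p. leaf_slope p (W i) \<and> poly F p = 0)"

lemma slope: "leaf_slope (slope i) (W i)" "poly F (slope i) = 0"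
  using presented someI_ex[of "\<lambda>p. leaf_slope p (W i) \<and> poly F p = 0"]
  by (auto simp: presents_def slope_def)

lemma pdx_W: "leaf_slope p (W i) \<Longrightarrow> \<partial>\<^sub>x (W i) = - (p * \<partial>\<^sub>y (W i))"
  by (simp add: leaf_slope_def eq_neg_iff_add_eq_0)

text \<open>Replacing each x-derivative by minus the slope times the y-derivative factors the
  Jacobian of two leaf functions, so no factor can vanish at the origin.\<close>

lemma slopes_at0:
  assumes "i \<noteq> j"
  shows "at0 (\<partial>\<^sub>y (W i)) \<noteq> 0" "at0 (slope i) \<noteq> at0 (slope j)"
proof -
  have "at0 (\<partial>\<^sub>x (W i) * \<partial>\<^sub>y (W j) - \<partial>\<^sub>y (W i) * \<partial>\<^sub>x (W j)) \<noteq> 0"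
    using nonsingular assms by (simp add: nonsingular_4web_def)
  also have "at0 (\<partial>\<^sub>x (W i) * \<partial>\<^sub>y (W j) - \<partial>\<^sub>y (W i) * \<partial>\<^sub>x (W j))
      = (at0 (slope j) - at0 (slope i)) * at0 (\<partial>\<^sub>y (W i)) * at0 (\<partial>\<^sub>y (W j))"
    by (simp add: pdx_W[OF slope(1)] algebra_simps)
  finally show "at0 (\<partial>\<^sub>y (W i)) \<noteq> 0" "at0 (slope i) \<noteq> at0 (slope j)" by auto
qed

lemma inj_slope: "inj slope"
  using slopes_at0(2) by (metis injI)

lemma leaf_slope_iff: "leaf_slope p (W i) \<longleftrightarrow> p = slope i"
proof
  assume "leaf_slope p (W i)"
  then have "p * \<partial>\<^sub>y (W i) = slope i * \<partial>\<^sub>y (W i)" using pdx_W slope(1) neg_equal_iff_equal by metis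
  \<comment> \<open>Any index other than i would serve in place of \<open>i + 1\<close>.\<close>
  moreover have "\<partial>\<^sub>y (W i) \<noteq> 0" using slopes_at0(1)[of i "i + 1"] by auto
  ultimately show "p = slope i" by simp
qed (use slope in simp)

lemma card_slopes: "card (range slope) = 4"
  using card_image[OF inj_slope] by simp

lemma coeff_F_at0: "at0 (coeff F 4) \<noteq> 0" and degree_F_le: "degree F \<le> 4"
  using presented by (simp_all add: presents_def)

text \<open>Four distinct slopes exhaust the roots of a nonzero polynomial of degree at most
  4.\<close>

lemma roots_eq: "poly F p = 0 \<longleftrightarrow> p \<in> range slope"
proof -
  have F: "F \<noteq> 0" using coeff_F_at0 by auto
  have "range slope = {p. poly F p = 0}"
    using F slope(2) card_slopes card_poly_roots_bound[OF F] degree_F_le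
    by (intro card_seteq poly_roots_finite) auto
  then show ?thesis by auto
qed

text \<open>The derivative at a root is a_0 times differences of slopes, and none of these factors
  vanishes at the origin. Hence the reciprocals required by the interpolation are germs.\<close>

lemma unit_pderiv: "at0 (poly (pderiv F) (slope i)) \<noteq> 0"
proof -
  have "poly (pderiv F) (slope i) = coeff F 4 * (\<Prod>y\<in>range slope - {slope i}. slope i - y)"
    using poly_pderiv_at_root[of "range slope" F "slope i"] degree_F_le slope by (auto simp: card_slopes)
  moreover have "at0 (slope i - y) \<noteq> 0" if y: "y \<in> range slope - {slope i}" for y
  proof -
    obtain j where j: "y = slope j" using y by blast
    then have "i \<noteq> j" using y by blast
    then show ?thesis using slopes_at0(2)[of i j] j by simp
  qed
  ultimately show ?thesis using coeff_F_at0 by (simp add: at0_prod)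
qed

sublocale germ_roots "range slope" F "\<lambda>p. inverse (poly (pderiv F) p)"
proof unfold_locales
  show "poly (pderiv F) p * inverse (poly (pderiv F) p) = 1" if "p \<in> range slope" for p
    using that unit_pderiv by (auto intro: germ_unit)
qed (use slope degree_F_le in \<open>auto simp: card_slopes\<close>)

text \<open>Four distinct nodes determine a polynomial of degree at most 3; the same argument
  identifies \<open>Q_poly\<close>.\<close>

lemma web_poly: "web_poly W = slope_poly"
  unfolding web_poly_def
proof (rule the_equality)
  fix P assume P: "degree P \<le> 3 \<and> (\<forall>i p. leaf_slope p (W i) \<longrightarrow> poly P p = \<partial>\<^sub>x p + p * \<partial>\<^sub>y p)"
  show "P = slope_poly"
    by (rule poly_eqI_degree[of "range slope"])
      (use P degree_lagrange in \<open>auto simp: card_slopes leaf_slope_iff poly_lagrange\<close>)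
qed (use degree_lagrange_le in \<open>auto simp: leaf_slope_iff poly_lagrange\<close>)

lemma Q_poly: "Q_poly F b = system_poly b"
  unfolding Q_poly_def Let_def divide_germ_def
proof (rule the_equality)
  fix P
  assume P: "degree P \<le> 2 \<and> (\<forall>p. poly F p = 0 \<longrightarrow> poly P p = poly (pderiv F) p *
     (\<partial>\<^sub>x ((b $ 1 * p + b $ 2) * inverse (poly (pderiv F) p)) +
      \<partial>\<^sub>y (p * (b $ 1 * p + b $ 2) * inverse (poly (pderiv F) p))))"
  show "P = system_poly b"
    by (rule poly_eqI_degree[of "range slope"])
      (use P degree_system_poly[of b] in \<open>auto simp: card_slopes roots_eq poly_system_poly\<close>)
qed (use degree_system_poly in \<open>simp add: roots_eq poly_system_poly\<close>)

lemma A_mat: "A_mat F = vector [vector [coeff slope_poly 0, coeff divergence_poly 0],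
    vector [coeff divergence_poly 0 + coeff slope_poly 1, coeff divergence_poly 1],
    vector [coeff divergence_poly 1 + coeff slope_poly 2, - coeff slope_poly 3]]" (is "_ = ?A")
  unfolding A_mat_def
proof (rule the_equality)
  have coeffs: "coeff [:a, b, c:] 0 = a" "coeff [:a, b, c:] 1 = b" "coeff [:a, b, c:] 2 = c" for a b c :: germ
    by (simp_all add: numeral_2_eq_2)
  show *: "\<forall>b. coeff (Q_poly F b) 0 = \<partial>\<^sub>x (b $ 2) + ?A $ 1 $ 1 * b $ 1 + ?A $ 1 $ 2 * b $ 2 \<and>
     coeff (Q_poly F b) 1 = \<partial>\<^sub>x (b $ 1) + \<partial>\<^sub>y (b $ 2) + ?A $ 2 $ 1 * b $ 1 + ?A $ 2 $ 2 * b $ 2 \<and>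
     coeff (Q_poly F b) 2 = \<partial>\<^sub>y (b $ 1) + ?A $ 3 $ 1 * b $ 1 + ?A $ 3 $ 2 * b $ 2"
    unfolding Q_poly system_poly_def Let_def coeffs by simp
  fix A :: "germ ^ 2 ^ 3"
  assume A: "\<forall>b. coeff (Q_poly F b) 0 = \<partial>\<^sub>x (b $ 2) + A $ 1 $ 1 * b $ 1 + A $ 1 $ 2 * b $ 2 \<and>
     coeff (Q_poly F b) 1 = \<partial>\<^sub>x (b $ 1) + \<partial>\<^sub>y (b $ 2) + A $ 2 $ 1 * b $ 1 + A $ 2 $ 2 * b $ 2 \<and>
     coeff (Q_poly F b) 2 = \<partial>\<^sub>y (b $ 1) + A $ 3 $ 1 * b $ 1 + A $ 3 $ 2 * b $ 2"
  \<comment> \<open>On the constant vectors (1, 0) and (0, 1) all derivatives vanish, so each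
    isolates one column of the matrix.\<close>
  have "A $ i $ j = ?A $ i $ j" for i j
    using A[rule_format, of "vector [1, 0]"] A[rule_format, of "vector [0, 1]"]
      *[rule_format, of "vector [1, 0]"] *[rule_format, of "vector [0, 1]"]
      exhaust_3[of i] exhaust_2[of j] by auto
  then show "A = ?A" unfolding Finite_Cartesian_Product.vec_eq_iff by blast
qed

end

section \<open>Coordinates on the jets and the connection in these coordinates\<close>

text \<open>The coordinates u, w, z stand for b_3, b_4 and the x-derivative of b_3; the remaining
  entries solve the system and its first derivatives. This trivializes E with rank 3, and u = w = 0
  describes the kernel.\<close>

definition jet_of :: "germ ^ 2 ^ 3 \<Rightarrow> germ \<Rightarrow> germ \<Rightarrow> germ \<Rightarrow> jet" where
  "jet_of A u w z = (let
     fx2 = - (A $ 1 $ 1 * u + A $ 1 $ 2 * w);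
     fy1 = - (A $ 3 $ 1 * u + A $ 3 $ 2 * w);
     fy2 = - (z + A $ 2 $ 1 * u + A $ 2 $ 2 * w);
     fxx2 = - (A $ 1 $ 1 * z + A $ 1 $ 2 * fx2 + \<partial>\<^sub>x (A $ 1 $ 1) * u + \<partial>\<^sub>x (A $ 1 $ 2) * w);
     fxy1 = - (A $ 3 $ 1 * z + A $ 3 $ 2 * fx2 + \<partial>\<^sub>x (A $ 3 $ 1) * u + \<partial>\<^sub>x (A $ 3 $ 2) * w);
     fxy2 = - (A $ 1 $ 1 * fy1 + A $ 1 $ 2 * fy2 + \<partial>\<^sub>y (A $ 1 $ 1) * u + \<partial>\<^sub>y (A $ 1 $ 2) * w);
     fyy1 = - (A $ 3 $ 1 * fy1 + A $ 3 $ 2 * fy2 + \<partial>\<^sub>y (A $ 3 $ 1) * u + \<partial>\<^sub>y (A $ 3 $ 2) * w);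
     fxx1 = - (fxy2 + A $ 2 $ 1 * z + A $ 2 $ 2 * fx2 + \<partial>\<^sub>x (A $ 2 $ 1) * u + \<partial>\<^sub>x (A $ 2 $ 2) * w);
     fyy2 = - (fxy1 + A $ 2 $ 1 * fy1 + A $ 2 $ 2 * fy2 + \<partial>\<^sub>y (A $ 2 $ 1) * u + \<partial>\<^sub>y (A $ 2 $ 2) * w)
   in (\<lambda>a b. if (a, b) = (0, 0) then vector [u, w]
     else if (a, b) = (1, 0) then vector [z, fx2] else if (a, b) = (0, 1) then vector [fy1, fy2]
     else if (a, b) = (2, 0) then vector [fxx1, fxx2] else if (a, b) = (1, 1) then vector [fxy1, fxy2]
     else if (a, b) = (0, 2) then vector [fyy1, fyy2] else 0))"

lemma vec2_eq_iff: "(v :: 'a ^ 2) = w \<longleftrightarrow> v $ 1 = w $ 1 \<and> v $ 2 = w $ 2"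
  by (simp add: Finite_Cartesian_Product.vec_eq_iff forall_2)

lemma vec3_eq_iff: "(v :: 'a ^ 3) = w \<longleftrightarrow> v $ 1 = w $ 1 \<and> v $ 2 = w $ 2 \<and> v $ 3 = w $ 3"
  by (simp add: Finite_Cartesian_Product.vec_eq_iff forall_3)

lemma M4_nth [simp]:
  "M4 F f $ 1 = f 1 0 $ 2 + (A_mat F $ 1 $ 1 * f 0 0 $ 1 + A_mat F $ 1 $ 2 * f 0 0 $ 2)"
  "M4 F f $ 2 = f 1 0 $ 1 + f 0 1 $ 2 + (A_mat F $ 2 $ 1 * f 0 0 $ 1 + A_mat F $ 2 $ 2 * f 0 0 $ 2)"
  "M4 F f $ 3 = f 0 1 $ 1 + (A_mat F $ 3 $ 1 * f 0 0 $ 1 + A_mat F $ 3 $ 2 * f 0 0 $ 2)"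
  by (simp_all add: M4_def matrix_vector_mult_def sum_2)

lemma matrix_map_mult_nth:
  "(matrix_map d A *v v) $ i = d (A $ i $ 1) * v $ 1 + d (A $ i $ 2) * v $ (2 :: 2)"
  by (simp add: matrix_map_def matrix_vector_mult_def sum_2)

text \<open>The nine equations defining $R_1$, solved successively for all components of the jet
  other than $f_{0,0}$ and the first component of $f_{1,0}$.\<close>

lemma R1_iff:
  fixes F f
  defines "A \<equiv> A_mat F"
  shows "f \<in> R1 F \<longleftrightarrow> f \<in> jets 2 \<and>
   f 1 0 $ 2 = - (A $ 1 $ 1 * f 0 0 $ 1 + A $ 1 $ 2 * f 0 0 $ 2) \<and>
   f 0 1 $ 1 = - (A $ 3 $ 1 * f 0 0 $ 1 + A $ 3 $ 2 * f 0 0 $ 2) \<and>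
   f 0 1 $ 2 = - (f 1 0 $ 1 + A $ 2 $ 1 * f 0 0 $ 1 + A $ 2 $ 2 * f 0 0 $ 2) \<and>
   f 2 0 $ 2 = - (A $ 1 $ 1 * f 1 0 $ 1 + A $ 1 $ 2 * f 1 0 $ 2
     + \<partial>\<^sub>x (A $ 1 $ 1) * f 0 0 $ 1 + \<partial>\<^sub>x (A $ 1 $ 2) * f 0 0 $ 2) \<and>
   f 1 1 $ 1 = - (A $ 3 $ 1 * f 1 0 $ 1 + A $ 3 $ 2 * f 1 0 $ 2
     + \<partial>\<^sub>x (A $ 3 $ 1) * f 0 0 $ 1 + \<partial>\<^sub>x (A $ 3 $ 2) * f 0 0 $ 2) \<and>
   f 1 1 $ 2 = - (A $ 1 $ 1 * f 0 1 $ 1 + A $ 1 $ 2 * f 0 1 $ 2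
     + \<partial>\<^sub>y (A $ 1 $ 1) * f 0 0 $ 1 + \<partial>\<^sub>y (A $ 1 $ 2) * f 0 0 $ 2) \<and>
   f 0 2 $ 1 = - (A $ 3 $ 1 * f 0 1 $ 1 + A $ 3 $ 2 * f 0 1 $ 2
     + \<partial>\<^sub>y (A $ 3 $ 1) * f 0 0 $ 1 + \<partial>\<^sub>y (A $ 3 $ 2) * f 0 0 $ 2) \<and>
   f 2 0 $ 1 = - (f 1 1 $ 2 + A $ 2 $ 1 * f 1 0 $ 1 + A $ 2 $ 2 * f 1 0 $ 2
     + \<partial>\<^sub>x (A $ 2 $ 1) * f 0 0 $ 1 + \<partial>\<^sub>x (A $ 2 $ 2) * f 0 0 $ 2) \<and>
   f 0 2 $ 2 = - (f 1 1 $ 1 + A $ 2 $ 1 * f 0 1 $ 1 + A $ 2 $ 2 * f 0 1 $ 2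
     + \<partial>\<^sub>y (A $ 2 $ 1) * f 0 0 $ 1 + \<partial>\<^sub>y (A $ 2 $ 2) * f 0 0 $ 2)"
  unfolding R1_def M4_x_def M4_y_def vec3_eq_iff A_def
  by (simp only: mem_Collect_eq vector_add_component zero_index M4_nth matrix_map_mult_nth
      eq_neg_iff_add_eq_0 one_add_one add_0 add_0_right add_ac) blast

lemma jet_of_0: "jet_of A u w z 0 0 = vector [u, w]"
  by (simp add: jet_of_def Let_def)

lemma jet_of_x1: "jet_of A u w z 1 0 $ 1 = z"
  by (simp add: jet_of_def Let_def)

lemma jet_of_mem_R1: "jet_of (A_mat F) u w z \<in> R1 F"
  unfolding R1_iff by (auto simp: jets_def jet_of_def Let_def)

lemma jet_of_unique:
  assumes f: "f \<in> R1 F" "f 0 0 = vector [u, w]" "f 1 0 $ 1 = z"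
  shows "f = jet_of (A_mat F) u w z"
proof (intro ext)
  fix a b :: nat
  let ?g = "jet_of (A_mat F) u w z"
  have g: "?g \<in> R1 F" by (rule jet_of_mem_R1)
  have 00: "f 0 0 = ?g 0 0" using f(2) by (simp add: jet_of_0)
  note fE = f(1)[unfolded R1_iff] and gE = g[unfolded R1_iff]
  have 10: "f 1 0 = ?g 1 0"
    unfolding vec2_eq_iff using f(3) fE gE 00 by (simp only: jet_of_x1)
  have 01: "f 0 1 = ?g 0 1"
    unfolding vec2_eq_iff using fE gE 00 10 by (simp only:)
  \<comment> \<open>The mixed component precedes the two pure ones because their equations refer to
    it.\<close>
  have 11: "f 1 1 = ?g 1 1"
    unfolding vec2_eq_iff using fE gE 00 10 01 by (simp only:)
  have 20: "f 2 0 = ?g 2 0"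
    unfolding vec2_eq_iff using fE gE 00 10 01 11 by (simp only:)
  have 02: "f 0 2 = ?g 0 2"
    unfolding vec2_eq_iff using fE gE 00 10 01 11 by (simp only:)
  consider "a + b > 2" | "a = 0" "b = 0" | "a = 1" "b = 0" | "a = 0" "b = 1"
    | "a = 2" "b = 0" | "a = 1" "b = 1" | "a = 0" "b = 2"
    by linarith
  then show "f a b = ?g a b"
  proof cases
    case 1
    then show ?thesis using fE gE by (simp add: jets_def)
  qed (simp_all only: 00 10 01 11 20 02)
qed

lemma M4_lincomb: "M4 F (lincomb e c) = (\<Sum>i\<in>UNIV. c $ i *s M4 F (e i))"
  by (simp add: vec3_eq_iff lincomb_def sum_3 algebra_simps)

lemma lincomb_mem_R1:
  assumes "\<And>i. e i \<in> R1 F"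
  shows "lincomb e c \<in> R1 F"
proof -
  have "M4_x F (lincomb e c) = (\<Sum>i\<in>UNIV. c $ i *s M4_x F (e i))"
    using M4_lincomb[of F "\<lambda>i a b. e i (a + 1) b" c]
    by (simp add: M4_x_def lincomb_def vec3_eq_iff sum_3 matrix_map_mult_nth algebra_simps)
  moreover have "M4_y F (lincomb e c) = (\<Sum>i\<in>UNIV. c $ i *s M4_y F (e i))"
    using M4_lincomb[of F "\<lambda>i a b. e i a (b + 1)" c]
    by (simp add: M4_y_def lincomb_def vec3_eq_iff sum_3 matrix_map_mult_nth algebra_simps)
  ultimately show ?thesis
    using assms by (simp add: R1_def M4_lincomb) (simp add: jets_def lincomb_def)
qed

text \<open>An element of \<open>R1 F\<close> is determined by three coordinates that depend
  linearly on it.\<close>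

lemma lincomb_jet_of:
  "lincomb (\<lambda>i. jet_of (A_mat F) (u i) (w i) (z i)) c =
    jet_of (A_mat F) (\<Sum>i\<in>UNIV. c $ i * u i) (\<Sum>i\<in>UNIV. c $ i * w i) (\<Sum>i\<in>UNIV. c $ i * z i)"
proof (rule jet_of_unique)
  show "lincomb (\<lambda>i. jet_of (A_mat F) (u i) (w i) (z i)) c 1 0 $ 1 = (\<Sum>i\<in>UNIV. c $ i * z i)"
    by (simp add: lincomb_def jet_of_x1[simplified])
qed (simp_all add: lincomb_mem_R1 jet_of_mem_R1, simp add: vec2_eq_iff lincomb_def jet_of_0)

lemma M4_truncate1: "M4 F (truncate1 f) = M4 F f"
  by (simp add: vec3_eq_iff truncate1_def)

lemma truncate1_mem_R0_iff: "truncate1 f \<in> R0 F \<longleftrightarrow> M4 F f = 0"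
  by (simp add: R0_def M4_truncate1 jets_def) (simp add: truncate1_def)

text \<open>The system applied to the Spencer operator gives the true derivative of
  \<open>M4 F f\<close> minus its formal derivative; the terms with derivatives of
  \<open>A_mat\<close> match by the Leibniz rule, and both sides of the difference are zero.\<close>

lemma spencer_mem_R0:
  assumes "f \<in> R1 F"
  shows "fst (spencer f) \<in> R0 F" "snd (spencer f) \<in> R0 F"
proof -
  have f: "M4 F f = 0" "M4_x F f = 0" "M4_y F f = 0" using assms by (auto simp: R1_def)
  have "M4 F (\<lambda>a b. vec_map \<partial>\<^sub>x (f a b) - f (a + 1) b) = vec_map \<partial>\<^sub>x (M4 F f) - M4_x F f"
    by (simp add: vec3_eq_iff vec_map_def M4_x_def matrix_map_mult_nth pdx_mult algebra_simps)
  moreover have "M4 F (\<lambda>a b. vec_map \<partial>\<^sub>y (f a b) - f a (b + 1)) = vec_map \<partial>\<^sub>y (M4 F f) - M4_y F f"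
    by (simp add: vec3_eq_iff vec_map_def M4_y_def matrix_map_mult_nth pdy_mult algebra_simps)
  moreover have "vec_map \<partial>\<^sub>x (0 :: germ ^ 3) = 0" "vec_map \<partial>\<^sub>y (0 :: germ ^ 3) = 0"
    by (simp_all add: vec3_eq_iff vec_map_def)
  ultimately show "fst (spencer f) \<in> R0 F" "snd (spencer f) \<in> R0 F"
    by (simp_all add: spencer_def truncate1_mem_R0_iff f)
qed

lemma R0_iff:
  fixes F f
  defines "A \<equiv> A_mat F"
  shows "f \<in> R0 F \<longleftrightarrow> f \<in> jets 1 \<and>
   f 1 0 $ 2 = - (A $ 1 $ 1 * f 0 0 $ 1 + A $ 1 $ 2 * f 0 0 $ 2) \<and>
   f 0 1 $ 1 = - (A $ 3 $ 1 * f 0 0 $ 1 + A $ 3 $ 2 * f 0 0 $ 2) \<and>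
   f 0 1 $ 2 = - (f 1 0 $ 1 + A $ 2 $ 1 * f 0 0 $ 1 + A $ 2 $ 2 * f 0 0 $ 2)"
  unfolding R0_def vec3_eq_iff A_def
  by (simp only: mem_Collect_eq zero_index M4_nth eq_neg_iff_add_eq_0 add_ac) blast

lemma R0_eqI:
  assumes "f \<in> R0 F" "g \<in> R0 F" "f 0 0 = g 0 0" "f 1 0 $ 1 = g 1 0 $ 1"
  shows "f = g"
proof (intro ext)
  fix a b :: nat
  note fE = assms(1)[unfolded R0_iff] and gE = assms(2)[unfolded R0_iff]
  have 10: "f 1 0 = g 1 0" and 01: "f 0 1 = g 0 1"
    unfolding vec2_eq_iff using fE gE assms(3,4) by simp_all
  consider "a + b > 1" | "a = 0" "b = 0" | "a = 1" "b = 0" | "a = 0" "b = 1"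
    by linarith
  then show "f a b = g a b"
  proof cases
    case 1
    then show ?thesis using fE gE by (simp add: jets_def)
  qed (simp_all only: assms(3) 10 01)
qed

lemma truncate1_R1: "f \<in> R1 F \<Longrightarrow> truncate1 f \<in> R0 F"
  by (simp add: truncate1_mem_R0_iff R1_def)

text \<open>Elements of \<open>R0 F\<close> and of \<open>R1 F\<close> are determined by the same
  three coordinates, all of order at most one and hence preserved by truncation.\<close>

lemma the_inv_into_truncate1:
  assumes g: "g \<in> R0 F"
  shows "the_inv_into (R1 F) truncate1 g = jet_of (A_mat F) (g 0 0 $ 1) (g 0 0 $ 2) (g 1 0 $ 1)"
proof (rule the_inv_into_f_eq)
  show "inj_on truncate1 (R1 F)"
  proof (rule inj_onI)
    fix f h assume fh: "f \<in> R1 F" "h \<in> R1 F" "truncate1 f = truncate1 h"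
    have "f 0 0 = h 0 0" "f 1 0 = h 1 0"
      using arg_cong[OF fh(3), of "\<lambda>g. g 0 0"] arg_cong[OF fh(3), of "\<lambda>g. g 1 0"]
      by (simp_all add: truncate1_def)
    then show "f = h"
      using jet_of_unique[OF fh(1)] jet_of_unique[OF fh(2)]
      by (metis vec2_eq_iff vector_2)
  qed
  show "jet_of (A_mat F) (g 0 0 $ 1) (g 0 0 $ 2) (g 1 0 $ 1) \<in> R1 F"
    by (rule jet_of_mem_R1)
  then show "truncate1 (jet_of (A_mat F) (g 0 0 $ 1) (g 0 0 $ 2) (g 1 0 $ 1)) = g"
    by (intro R0_eqI[OF truncate1_R1 g])
      (simp_all add: truncate1_def vec2_eq_iff jet_of_0 jet_of_x1[simplified])
qed

lemma nabla_R1: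
  assumes "f \<in> R1 F"
  shows "nabla F f =
    (jet_of (A_mat F) (\<partial>\<^sub>x (f 0 0 $ 1) - f 1 0 $ 1) (\<partial>\<^sub>x (f 0 0 $ 2) - f 1 0 $ 2) (\<partial>\<^sub>x (f 1 0 $ 1) - f 2 0 $ 1),
     jet_of (A_mat F) (\<partial>\<^sub>y (f 0 0 $ 1) - f 0 1 $ 1) (\<partial>\<^sub>y (f 0 0 $ 2) - f 0 1 $ 2) (\<partial>\<^sub>y (f 1 0 $ 1) - f 1 1 $ 1))"
  using the_inv_into_truncate1[OF spencer_mem_R0(1)[OF assms]]
    the_inv_into_truncate1[OF spencer_mem_R0(2)[OF assms]]
  by (simp add: nabla_def map_prod_def case_prod_unfold)
    (simp add: spencer_def truncate1_def vec_map_def numeral_2_eq_2)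

lemma nabla_jet_of:
  fixes F u w z
  defines "A \<equiv> A_mat F"
  defines "fx2 \<equiv> - (A $ 1 $ 1 * u + A $ 1 $ 2 * w)"
    and "fy1 \<equiv> - (A $ 3 $ 1 * u + A $ 3 $ 2 * w)"
    and "fy2 \<equiv> - (z + A $ 2 $ 1 * u + A $ 2 $ 2 * w)"
  shows "nabla F (jet_of A u w z) =
    (jet_of A (\<partial>\<^sub>x u - z) (\<partial>\<^sub>x w - fx2)
       (\<partial>\<^sub>x z - (A $ 1 $ 1 * fy1 + A $ 1 $ 2 * fy2 + \<partial>\<^sub>y (A $ 1 $ 1) * u + \<partial>\<^sub>y (A $ 1 $ 2) * w
         - (A $ 2 $ 1 * z + A $ 2 $ 2 * fx2 + \<partial>\<^sub>x (A $ 2 $ 1) * u + \<partial>\<^sub>x (A $ 2 $ 2) * w))),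
     jet_of A (\<partial>\<^sub>y u - fy1) (\<partial>\<^sub>y w - fy2)
       (\<partial>\<^sub>y z + A $ 3 $ 1 * z + A $ 3 $ 2 * fx2 + \<partial>\<^sub>x (A $ 3 $ 1) * u + \<partial>\<^sub>x (A $ 3 $ 2) * w))"
  unfolding A_def nabla_R1[OF jet_of_mem_R1]
  by (simp add: jet_of_def[of "A_mat F" u w z] Let_def fx2_def fy1_def fy2_def A_def algebra_simps)

section \<open>The adapted basis and its curvature\<close>

text \<open>The relations A_{2,1} = A_{1,2} - v_3 and A_{3,1} = A_{2,2} - v_2 are built into the
  matrix. Carrying one third as a germ t with 3t = 1 reduces everything to identities in a
  commutative differential ring.\<close>

locale normalized_system =
  fixes F :: "germ poly" and a b c d p q t :: germ
  assumes third: "3 * t = 1"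
    and A_mat_eq: "A_mat F = vector [vector [- d, p + c], vector [p - 2 * c, q + 2 * b], vector [q - b, a]]"
begin

definition basis :: "3 \<Rightarrow> jet" where
  "basis i = jet_of (A_mat F) (vector [0, 1, 0] $ i) (vector [0, 0, - 1] $ i) (vector [t, c - p, b] $ i)"

text \<open>The dx-part; \<open>conn_y\<close> is the dy-part. With the shifts c - p and b in
  \<open>basis\<close>, the traces of the two are 3p and 3q.\<close>

definition conn_x :: "germ ^ 3 ^ 3" where
  "conn_x = vector [
     vector [p, 3 * (2 * b * d - 2 * c * c - \<partial>\<^sub>x c + \<partial>\<^sub>y d),
       3 * (a * d - b * c - \<partial>\<^sub>x b + \<partial>\<^sub>y c + \<partial>\<^sub>y p - \<partial>\<^sub>x q)],
     vector [- t, p - c, - b],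
     vector [0, d, c + p]]"

definition conn_y :: "germ ^ 3 ^ 3" where
  "conn_y = vector [
     vector [q, 3 * (a * d - b * c - \<partial>\<^sub>x b + \<partial>\<^sub>y c - \<partial>\<^sub>y p + \<partial>\<^sub>x q),
       3 * (2 * a * c - \<partial>\<^sub>x a - 2 * b * b + \<partial>\<^sub>y b)],
     vector [0, q - b, - a],
     vector [- t, c, b + q]]"

lemma lincomb_basis:
  "lincomb basis k = jet_of (A_mat F) (k $ 2) (- k $ 3) (t * k $ 1 + (c - p) * k $ 2 + b * k $ 3)"
  using lincomb_jet_of[of F "\<lambda>i. vector [0, 1, 0] $ i" "\<lambda>i. vector [0, 0, - 1] $ i" "\<lambda>i. vector [t, c - p, b] $ i" k]
  by (simp add: basis_def[abs_def] sum_3 mult_ac)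

lemma jet_of_eq_iff: "jet_of A u w z = jet_of A u' w' z' \<longleftrightarrow> u = u' \<and> w = w' \<and> z = z'"
  by (metis jet_of_0 jet_of_x1 vector_2)

lemma third_mult: "t * (3 * f) = f"
  using third by (metis mult.assoc mult.commute mult_1)

lemma third_ac:
  "t * 3 = 1" "t * (f * 3) = f" "t * (f * (3 * g)) = f * g"
  "t * 6 = 2" "t * (6 * f) = 2 * f" "t * (f * 6) = 2 * f" "t * (f * (6 * g)) = 2 * (f * g)"
proof -
  show *: "t * 3 = 1" "t * (f * 3) = f" "t * (f * (3 * g)) = f * g" for f g
    using third_mult[of 1] third_mult[of f] third_mult[of "f * g"] by (simp_all add: mult_ac)
  have 6: "(6 :: germ) = 3 * 2" by simp
  show "t * 6 = 2" "t * (6 * f) = 2 * f" "t * (f * 6) = 2 * f" "t * (f * (6 * g)) = 2 * (f * g)"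
    using third_mult[of 2] third_mult[of "2 * f"] third_mult[of "2 * (f * g)"]
    unfolding 6 by (simp_all only: mult_ac)
qed

lemma third_const: "\<partial>\<^sub>x t = 0" "\<partial>\<^sub>y t = 0"
proof -
  have "t * \<partial>\<^sub>x (3 * t) = 0" "t * \<partial>\<^sub>y (3 * t) = 0" unfolding third by simp_all
  then show "\<partial>\<^sub>x t = 0" "\<partial>\<^sub>y t = 0" by (simp_all add: pdx_mult pdy_mult third_mult)
qed

lemma adapted: "adapted_basis F basis"
  unfolding adapted_basis_def
proof (intro conjI allI ballI)
  show "basis i \<in> R1 F" for i by (simp add: basis_def jet_of_mem_R1)
  fix f assume f: "f \<in> R1 F"
  let ?u = "f 0 0 $ 1" and ?w = "f 0 0 $ 2" and ?z = "f 1 0 $ 1"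
  have f_eq: "f = jet_of (A_mat F) ?u ?w ?z"
    using f by (rule jet_of_unique) (simp_all add: vec2_eq_iff)
  show "\<exists>!k. f = lincomb basis k"
  proof (rule ex1I)
    \<comment> \<open>The witness inverts the coordinate change of \<open>lincomb_basis\<close>; the
      sign of \<open>b * ?w\<close> comes from k_3 = -w.\<close>
    show "f = lincomb basis (vector [3 * (?z - (c - p) * ?u + b * ?w), ?u, - ?w])"
      by (subst f_eq) (simp add: lincomb_basis third_mult jet_of_eq_iff algebra_simps)
    fix k assume "f = lincomb basis k"
    then have "?u = k $ 2" "?w = - k $ 3" "?z = t * k $ 1 + (c - p) * k $ 2 + b * k $ 3"
      by (simp_all add: lincomb_basis jet_of_0 jet_of_x1[simplified])
    then show "k = vector [3 * (?z - (c - p) * ?u + b * ?w), ?u, - ?w]"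
      using third_mult[of "k $ 1"] by (simp add: vec3_eq_iff algebra_simps)
  qed
next
  have eq: "lincomb basis (vector [k, 0, 0]) = (\<lambda>a b. k *s basis 1 a b)" for k
    by (simp add: lincomb_def sum_3)
  show "{f \<in> R1 F. f 0 0 = 0} = {\<lambda>a b. k *s basis 1 a b | k. True}"
  proof safe
    fix f assume f: "f \<in> R1 F" "f 0 0 = 0"
    have "f = jet_of (A_mat F) 0 0 (f 1 0 $ 1)"
      using f by (intro jet_of_unique) (simp_all add: vec2_eq_iff)
    also have "\<dots> = lincomb basis (vector [3 * f 1 0 $ 1, 0, 0])"
      by (simp add: lincomb_basis third_mult)
    finally show "\<exists>k. f = (\<lambda>a b. k *s basis 1 a b) \<and> True" unfolding eq by blast
  next
    fix k
    show "(\<lambda>a b. k *s basis 1 a b) \<in> R1 F"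
      unfolding eq[symmetric] by (rule lincomb_mem_R1) (simp add: basis_def jet_of_mem_R1)
    show "k *s basis 1 0 0 = 0"
      by (simp add: basis_def jet_of_0 vec2_eq_iff)
  qed
qed

text \<open>Since jets are compared through u, w and z, the claim amounts to three scalar identities
  in each of the two directions.\<close>

lemma connection: "connection_matrix F basis (conn_x, conn_y)"
  unfolding connection_matrix_def
proof
  fix k :: "germ ^ 3"
  have vx: "vec_map \<partial>\<^sub>x k $ i = \<partial>\<^sub>x (k $ i)" and vy: "vec_map \<partial>\<^sub>y k $ i = \<partial>\<^sub>y (k $ i)" for i
    by (simp_all add: vec_map_def)
  have mul: "(M *v k) $ i = M $ i $ 1 * k $ 1 + M $ i $ 2 * k $ 2 + M $ i $ 3 * k $ 3" for M :: "germ ^ 3 ^ 3" and i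
    by (simp add: matrix_vector_mult_def sum_3)
  show "nabla F (lincomb basis k) =
      (lincomb basis (vec_map \<partial>\<^sub>x k + fst (conn_x, conn_y) *v k),
       lincomb basis (vec_map \<partial>\<^sub>y k + snd (conn_x, conn_y) *v k))"
    unfolding lincomb_basis nabla_jet_of prod.inject jet_of_eq_iff fst_conv snd_conv
      vector_add_component vx vy mul
    by (simp add: A_mat_eq conn_x_def conn_y_def pdx_mult pdy_mult third_const distrib_left third_mult)
      (simp add: third_mult third_ac algebra_simps)
qed

lemma matrix_mult_nth_3:
  "(M ** N) $ i $ j = M $ i $ 1 * N $ 1 $ j + M $ i $ 2 * N $ 2 $ j + M $ i $ 3 * N $ 3 $ j"
  for M N :: "germ ^ 3 ^ 3"
  by (simp add: matrix_matrix_mult_def sum_3)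

definition curv :: germ where "curv = \<partial>\<^sub>x q - \<partial>\<^sub>y p"

text \<open>A commutator has trace zero, so the curvature has the trace of d\<gamma>, namely three
  times \<open>curv\<close>; as the last two rows vanish, this is the first entry. The other entries
  follow by expansion, with mixed derivatives commuting.\<close>

lemma curvature:
  "curvature_matrix (conn_x, conn_y) = vector [
     vector [3 * curv, 
       3 * \<partial>\<^sub>x curv + (2 * \<partial>\<^sub>x (\<partial>\<^sub>y (3 * c)) - \<partial>\<^sub>x (\<partial>\<^sub>x (3 * b)) - 3 * \<partial>\<^sub>y (\<partial>\<^sub>y d) - 3 * \<partial>\<^sub>y (3 * b * d)
     + 2 * (3 * c) * \<partial>\<^sub>y (3 * c) - (3 * c) * \<partial>\<^sub>x (3 * b) + 3 * \<partial>\<^sub>x (a * d) + 3 * d * \<partial>\<^sub>x a),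
       3 * \<partial>\<^sub>y curv + (2 * \<partial>\<^sub>x (\<partial>\<^sub>y (3 * b)) - \<partial>\<^sub>y (\<partial>\<^sub>y (3 * c)) - 3 * \<partial>\<^sub>x (\<partial>\<^sub>x a) + 3 * \<partial>\<^sub>x (a * (3 * c))
     - 2 * (3 * b) * \<partial>\<^sub>x (3 * b) + (3 * b) * \<partial>\<^sub>y (3 * c) - 3 * \<partial>\<^sub>y (a * d) - 3 * a * \<partial>\<^sub>y d)],
     vector [0, 0, 0], vector [0, 0, 0]]"
proof -
  have m: "matrix_map D M $ i $ j = D (M $ i $ j)" for D and M :: "germ ^ 3 ^ 3" and i j
    by (simp add: matrix_map_def)
  show ?thesis
    unfolding curvature_matrix_def vec3_eq_iff fst_conv snd_conv
      vector_add_component vector_minus_component m matrix_mult_nth_3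
    by (simp add: conn_x_def conn_y_def curv_def pdx_mult pdy_mult third_const pdx_pdy_commute
        third_mult third_ac algebra_simps)
qed

end

section \<open>Specialization to the web\<close>

context presented_web
begin

text \<open>The web cubic is written with binomial coefficients as -(a p^3 + 3 b p^2 + 3 c p + d), p
  being here the slope variable. The germs p and q defined below are the components of the 1-form
  whose differential gives \<kappa>.\<close>

definition a where "a = v_coeff W 1"
definition b where "b = inverse 3 * v_coeff W 2"
definition c where "c = inverse 3 * v_coeff W 3"
definition d where "d = v_coeff W 4"
definition p where "p = A_mat F $ 1 $ 2 - c"
definition q where "q = A_mat F $ 2 $ 2 - 2 * b"

lemma v_coeffs: "v_coeff W 1 = a" "v_coeff W 2 = 3 * b" "v_coeff W 3 = 3 * c" "v_coeff W 4 = d"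
proof -
  have "3 * inverse (3 :: germ) = 1" by (rule germ_unit) simp
  then have "3 * (inverse 3 * f) = f" for f :: germ by (metis mult.assoc mult_1)
  then show "v_coeff W 1 = a" "v_coeff W 2 = 3 * b" "v_coeff W 3 = 3 * c" "v_coeff W 4 = d"
    by (simp_all add: a_def b_def c_def d_def)
qed

lemma slope_poly_coeffs:
  "coeff slope_poly 3 = - a" "coeff slope_poly 2 = - (3 * b)" "coeff slope_poly 1 = - (3 * c)"
  "coeff slope_poly 0 = - d"
  using v_coeffs by (simp_all add: v_coeff_def web_poly minus_equation_iff[of "coeff _ _"])

sublocale normalized_system F a b c d p q "inverse 3"
proof
  show "3 * inverse (3 :: germ) = 1" by (rule germ_unit) simp
  show "A_mat F = vector [vector [- d, p + c], vector [p - 2 * c, q + 2 * b], vector [q - b, a]]"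
    unfolding p_def q_def unfolding A_mat slope_poly_coeffs
    by (simp add: vec3_eq_iff vec2_eq_iff algebra_simps)
qed

lemma kappa: "kappa F W = \<partial>\<^sub>x q - \<partial>\<^sub>y p"
proof -
  have "2 / 3 * v_coeff W 2 = 2 * b" "1 / 3 * v_coeff W 3 = c"
    by (simp_all add: divide_germ_def b_def c_def mult.assoc)
  then show ?thesis by (simp add: kappa_def p_def q_def)
qed

lemma curvature_web: "curvature_matrix (conn_x, conn_y) =
    vector [vector [3 * kappa F W, 3 * \<partial>\<^sub>x (kappa F W) + L1 W, 3 * \<partial>\<^sub>y (kappa F W) + L2 W],
      vector [0, 0, 0], vector [0, 0, 0]]"
  unfolding curvature L1_def L2_def Let_def v_coeffs kappa curv_def ..

end

theorem proposition2:
  fixes W :: "4 \<Rightarrow> germ" and F :: "germ poly"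
  assumes "nonsingular_4web W" and "presents F W"
  shows "\<exists>e \<gamma>. adapted_basis F e \<and> connection_matrix F e \<gamma> \<and>
    curvature_matrix \<gamma> =
      vector [vector [3 * kappa F W, 3 * \<partial>\<^sub>x (kappa F W) + L1 W, 3 * \<partial>\<^sub>y (kappa F W) + L2 W],
              vector [0, 0, 0],
              vector [0, 0, 0]]"
proof -
  interpret presented_web W F by unfold_locales (fact assms)+
  show ?thesis using adapted connection curvature_web by blast
qed

end
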